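(* Let $\{\eta(t):t\ge0\}$ be a configuration process with dual process $\{\xi(t):t\ge0\}$ and duality function $D$ satisfying the standing assumptions listed in the context, and assume that there exists a successful coupling for the dual process. Then: 1. For every tempered invariant probability measure $\mu$ of $\{\eta(t)\}$ there exists a function $f:\mathbb{N}\to[0,\infty)$ such that for all $n\in\mathbb{N}$ and all $\xi\in\Omega_n$, $\widehat{\mu}(\xi)=f(n)$. 2. If $\mu$ is a probability measure on $\Omega$ which is tempered, invariant and ergodic, then the function $f$ from item 1 satisfies $f(n)=f(1)^n$ for all $n$. As a consequence, $\mu$ is a product measure.
   Context: **Configurations.** $G$ is an infinite countable set, $\mathbb{N}=\{0,1,2,\dots\}$, and $\{\eta(t):t\ge0\}$ is a Markov process on (a subset of) $\Omega=\mathbb{N}^G$ with semigroup $S(t)f(\eta)=\mathbb{E}_\eta f(\eta(t))$. For $\xi\in\Omega$ let $|\xi|=\sum_{x\in G}\xi_x$; $\Omega_f=\{\xi\in\Omega:|\xi|<\infty\}$ and $\Omega_n=\{\xi\in\Omega:|\xi|=n\}$. **Duality (standing assumptions).** There is a Markov process $\{\xi(t):t\ge0\}$ on $\Omega_f$ (the dual process, with path space measure $\widehat{\mathbb{P}}_\xi$ and expectation $\widehat{\mathbb{E}}_\xi$ when started from $\xi$) and a function $D:\Omega_f\times\Omega\to[0,\infty)$ with $\mathbb{E}_\eta D(\xi,\eta(t))=\widehat{\mathbb{E}}_\xi D(\xi(t),\eta)$ and $D(\emptyset,\eta)=1$ ($\emptyset$ the empty configuration). Moreover $D$ is of homogeneous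 factorized form $D(\xi,\eta)=\prod_{x\in G}d(\xi_x,\eta_x)$, with $d(0,n)=1$, $d(k,\cdot)$ a non-negative polynomial of degree $k$, and every polynomial $p(n)$ of degree $k$ is a linear combination of the polynomials $d(r,n)$, $0\le r\le k$. The number of particles is conserved both in $\{\eta(t)\}$ and in $\{\xi(t)\}$. **Dual process (standing assumptions).** The dual process is irreducible on each $\Omega_n$, and for all $\xi,\xi'\in\Omega_f$, $\lim_{t\to\infty}\widehat{\mathbb{P}}_\xi(\xi(t)\perp\xi')=1$, where $\xi\perp\xi'$ means that the supports of $\xi$ and $\xi'$ are disjoint. **$D$-transform and tempered measures.** For a probability measure $\mu$ on $\Omega$, $\widehat\mu(\xi)=\int D(\xi,\eta)\,d\mu(\eta)$, $\xi\in\Omega_f$ (integrability is implicitly assumed). $\mu$ is tempered if (1) for all $n\in\mathbb{N}$, $\sup_{|\xi|\le n}\int D(\xi,\eta)\,d\mu(\eta)<\infty$; (2) $\mu$ is determined by its $D$-transform, i.e. $\widehat\mu=\widehat\nu$ if and only if $\mu=\nu$; (3) the vector space spanned by $\{D(\xi,\cdot):\xi\in\Omega_f\}$ is dense in $L^2(\mu)$. **Ergodic.** An invariant probability measure $\mu$ of $\{\eta(t)\}$ is ergodic if for any $f\in L^2(\mu)$, $S(t)f=f$ for all $t\ge0$ implies $f=\int f\,d\mu$ almost surely. **Successful coupling.** The dual process admits a successful coupling if for all $n\in\mathbb{N}$ and $\xi,\xi'\in\Omega_n$ there is a coupling $\{(\xi^{(1)}(t),\xi^{(2)}(t)):t\ge0\}$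 of the dual processes started from $\xi$ and $\xi'$ such that $\tau_{\xi,\xi'}=\inf\{T>0:\xi^{(1)}(t)=\xi^{(2)}(t)\text{ for all }t\ge T\}$ is almost surely finite. *)

theory Defs
  imports "HOL-Probability.Probability" "HOL-Library.Groups_Big_Fun"
begin

section \<open>Configurations\<close>

text \<open>The set of sites \<open>G\<close> is the type \<open>'g\<close>, of class \<open>countable\<close>; infinity of \<open>G\<close> is an
  assumption of the locale \<open>dual_config_process\<close> below.\<close>

type_synonym 'g config = "'g \<Rightarrow> nat"

definition num_particles :: "'g config \<Rightarrow> enat" where
  "num_particles \<xi> = (\<Sum>\<^sub>\<infinity>x\<in>UNIV. enat (\<xi> x))"

lemma num_particles_finite_support:
  assumes "finite {x. \<xi> x \<noteq> 0}"
  shows "num_particles \<xi> = enat (\<Sum>x | \<xi> x \<noteq> 0. \<xi> x)"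
proof -
  have "num_particles \<xi> = (\<Sum>\<^sub>\<infinity>x\<in>{x. \<xi> x \<noteq> 0}. enat (\<xi> x))"
    unfolding num_particles_def by (rule infsum_cong_neutral) (auto simp: zero_enat_def)
  also have "\<dots> = (\<Sum>x | \<xi> x \<noteq> 0. enat (\<xi> x))"
    using assms by simp
  also have "\<dots> = enat (\<Sum>x | \<xi> x \<noteq> 0. \<xi> x)"
    by (simp flip: of_nat_eq_enat)
  finally show ?thesis .
qed

lemma num_particles_infinite_support:
  assumes "infinite {x. \<xi> x \<noteq> 0}"
  shows "num_particles \<xi> = \<infinity>"
proof (rule ccontr)
  assume "num_particles \<xi> \<noteq> \<infinity>"
  then obtain m where m: "num_particles \<xi> = enat m" by auto
  obtain F where F: "F \<subseteq> {x. \<xi> x \<noteq> 0}" "finite F" "card F = Suc m"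
    using assms infinite_arbitrarily_large by blast
  have "(\<Sum>x\<in>F. enat (\<xi> x)) \<le> num_particles \<xi>"
    unfolding num_particles_def by (simp only: nonneg_infsum_complete[OF i0_lb]) (rule SUP_upper, use F in auto)
  moreover have "(\<Sum>x\<in>F. enat (\<xi> x)) = enat (\<Sum>x\<in>F. \<xi> x)"
    by (simp flip: of_nat_eq_enat)
  moreover have "(\<Sum>x\<in>F. \<xi> x) \<ge> (\<Sum>x\<in>F. 1)"
    using F by (intro sum_mono) (auto simp: Suc_le_eq)
  ultimately show False using m F by auto
qed

definition fin_configs :: "'g config set" where
  "fin_configs = {\<xi>. num_particles \<xi> < \<infinity>}"

definition n_configs :: "nat \<Rightarrow> 'g config set" where
  "n_configs n = {\<xi>. num_particles \<xi> = enat n}"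

definition config_space :: "'g config measure" where
  "config_space = (\<Pi>\<^sub>M x\<in>UNIV. count_space UNIV)"

definition disjoint_supp :: "'g config \<Rightarrow> 'g config \<Rightarrow> bool" where
  "disjoint_supp \<xi> \<xi>' \<longleftrightarrow> {x. \<xi> x \<noteq> 0} \<inter> {x. \<xi>' x \<noteq> 0} = {}"


section \<open>Markov processes\<close>

text \<open>
  \<open>P x\<close> is the law of the process started from \<open>x\<close>, on a path space \<open>W\<close> with the trace of the
  product \<open>\<sigma>\<close>-algebra; paths are functions on \<open>{0..}\<close>. The set \<open>W\<close> is an arbitrary parameter, so
  no path regularity is imposed. It matters for statements about uncountably many times: almost
  sure coalescence of two paths can only hold on a proper path space such as the
  right-continuous paths with left limits, and never on the space of all paths.

  In \<open>markov\<close>, the sets \<open>{\<omega>. restrict \<omega> {0..s} \<in> A}\<close> form the \<open>\<sigma>\<close>-algebra generated by the path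
  up to time \<open>s\<close>.
\<close>

definition path_space :: "'s measure \<Rightarrow> (real \<Rightarrow> 's) set \<Rightarrow> (real \<Rightarrow> 's) measure" where
  "path_space E W = restrict_space (\<Pi>\<^sub>M t\<in>{0..}. E) W"

locale markov_process =
  fixes E :: "'s measure"
    and W :: "(real \<Rightarrow> 's) set"
    and P :: "'s \<Rightarrow> (real \<Rightarrow> 's) measure"
  assumes kernel: "P \<in> E \<rightarrow>\<^sub>M prob_algebra (path_space E W)"
    and start: "x \<in> space E \<Longrightarrow> AE \<omega> in P x. \<omega> 0 = x"
    and markov: "\<lbrakk>x \<in> space E; 0 \<le> s; 0 \<le> t; A \<in> sets (\<Pi>\<^sub>M u\<in>{0..s}. E); B \<in> sets E\<rbrakk> \<Longrightarrow>
      emeasure (P x) {\<omega> \<in> space (P x). restrict \<omega> {0..s} \<in> A \<and> \<omega> (s + t) \<in> B} =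
      (\<integral>\<^sup>+\<omega>. indicator A (restrict \<omega> {0..s}) *
          emeasure (P (\<omega> s)) {\<omega>' \<in> space (P (\<omega> s)). \<omega>' t \<in> B} \<partial>P x)"

definition semigroup_op ::
    "('s \<Rightarrow> (real \<Rightarrow> 's) measure) \<Rightarrow> real \<Rightarrow> ('s \<Rightarrow> real) \<Rightarrow> 's \<Rightarrow> real" where
  "semigroup_op P t f x = (\<integral>\<omega>. f (\<omega> t) \<partial>P x)"


section \<open>Couplings\<close>

definition is_coupling :: "'a measure \<Rightarrow> 'b measure \<Rightarrow> ('a \<times> 'b) measure \<Rightarrow> bool" where
  "is_coupling M N Q \<longleftrightarrow> sets Q = sets (M \<Otimes>\<^sub>M N) \<and> prob_space Q \<and>
     distr Q M fst = M \<and> distr Q N snd = N"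

text \<open>The infimum of the empty set is \<open>\<infinity>\<close>.\<close>

definition coupling_time :: "(real \<Rightarrow> 's) \<Rightarrow> (real \<Rightarrow> 's) \<Rightarrow> ereal" where
  "coupling_time \<omega> \<omega>' = Inf {ereal T | T. T > 0 \<and> (\<forall>t\<ge>T. \<omega> t = \<omega>' t)}"

definition admits_successful_coupling ::
    "('g config \<Rightarrow> (real \<Rightarrow> 'g config) measure) \<Rightarrow> bool" where
  "admits_successful_coupling P \<longleftrightarrow>
     (\<forall>n. \<forall>\<xi>\<in>n_configs n. \<forall>\<xi>'\<in>n_configs n. \<exists>Q. is_coupling (P \<xi>) (P \<xi>') Q \<and>
        (AE \<omega> in Q. coupling_time (fst \<omega>) (snd \<omega>) < \<infinity>))"


section \<open>Configuration processes with a dual\<close>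

text \<open>
  \<open>\<Gamma>\<close> is the state space of the configuration process and \<open>P\<close> its path measures; \<open>Pd\<close> are the path
  measures of the dual process. The expectations in \<open>duality\<close> are of non-negative functions and are
  taken in \<open>[0, \<infinity>]\<close>. \<open>Prod_any\<close> is the product over all sites; all but finitely many
  factors are 1 since \<open>d 0 n = 1\<close>.
\<close>

locale dual_config_process =
  config: markov_process "restrict_space config_space \<Gamma>" W P +
  dual: markov_process "count_space fin_configs" Wd Pd
  for \<Gamma> :: "('g::countable) config set"
    and W :: "(real \<Rightarrow> 'g config) set"
    and P :: "'g config \<Rightarrow> (real \<Rightarrow> 'g config) measure"
    and Wd :: "(real \<Rightarrow> 'g config) set"
    and Pd :: "'g config \<Rightarrow> (real \<Rightarrow> 'g config) measure" +
  fixes D :: "'g config \<Rightarrow> 'g config \<Rightarrow> real"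
    and d :: "nat \<Rightarrow> nat \<Rightarrow> real"
  assumes infinite_sites: "infinite (UNIV :: 'g set)"
    and state_space: "\<Gamma> \<in> sets config_space"
    and D_nonneg: "\<xi> \<in> fin_configs \<Longrightarrow> 0 \<le> D \<xi> \<eta>"
    and duality: "\<lbrakk>\<xi> \<in> fin_configs; \<eta> \<in> \<Gamma>; 0 \<le> t\<rbrakk> \<Longrightarrow>
      (\<integral>\<^sup>+\<omega>. ennreal (D \<xi> (\<omega> t)) \<partial>P \<eta>) = (\<integral>\<^sup>+\<omega>. ennreal (D (\<omega> t) \<eta>) \<partial>Pd \<xi>)"
    and D_empty: "D (\<lambda>_. 0) \<eta> = 1"
    and D_factorized: "\<xi> \<in> fin_configs \<Longrightarrow> D \<xi> \<eta> = Prod_any (\<lambda>x. d (\<xi> x) (\<eta> x))"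
    and d_zero: "d 0 n = 1"
    and d_nonneg: "0 \<le> d k n"
    and d_poly: "\<exists>p :: real poly. degree p = k \<and> (\<forall>n. d k n = poly p (real n))"
    and d_spans: "degree (p :: real poly) = k \<Longrightarrow>
      \<exists>c. \<forall>n. poly p (real n) = (\<Sum>r\<le>k. c r * d r n)"
    and config_conserved: "\<lbrakk>\<eta> \<in> \<Gamma>; 0 \<le> t\<rbrakk> \<Longrightarrow>
      AE \<omega> in P \<eta>. num_particles (\<omega> t) = num_particles \<eta>"
    and dual_conserved: "\<lbrakk>\<xi> \<in> fin_configs; 0 \<le> t\<rbrakk> \<Longrightarrow>
      AE \<omega> in Pd \<xi>. num_particles (\<omega> t) = num_particles \<xi>"
    and dual_irreducible: "\<lbrakk>\<xi> \<in> n_configs m; \<xi>' \<in> n_configs m\<rbrakk> \<Longrightarrow>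
      \<exists>t\<ge>0. measure (Pd \<xi>) {\<omega> \<in> space (Pd \<xi>). \<omega> t = \<xi>'} > 0"
    and dual_spreads: "\<lbrakk>\<xi> \<in> fin_configs; \<xi>' \<in> fin_configs\<rbrakk> \<Longrightarrow>
      ((\<lambda>t. measure (Pd \<xi>) {\<omega> \<in> space (Pd \<xi>). disjoint_supp (\<omega> t) \<xi>'}) \<longlongrightarrow> 1) at_top"


section \<open>Tempered, invariant, ergodic and product measures\<close>

definition D_integrable :: "('g config \<Rightarrow> 'g config \<Rightarrow> real) \<Rightarrow> 'g config measure \<Rightarrow> bool" where
  "D_integrable D \<mu> \<longleftrightarrow> (\<forall>\<xi>\<in>fin_configs. integrable \<mu> (D \<xi>))"

definition D_transform ::
    "('g config \<Rightarrow> 'g config \<Rightarrow> real) \<Rightarrow> 'g config measure \<Rightarrow> 'g config \<Rightarrow> real" where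
  "D_transform D \<mu> \<xi> = (\<integral>\<eta>. D \<xi> \<eta> \<partial>\<mu>)"

definition L2 :: "'a measure \<Rightarrow> ('a \<Rightarrow> real) set" where
  "L2 \<mu> = {f \<in> borel_measurable \<mu>. integrable \<mu> (\<lambda>x. (f x)\<^sup>2)}"

definition D_span :: "('g config \<Rightarrow> 'g config \<Rightarrow> real) \<Rightarrow> ('g config \<Rightarrow> real) set" where
  "D_span D = {\<lambda>\<eta>. \<Sum>\<xi>\<in>F. c \<xi> * D \<xi> \<eta> | F c. finite F \<and> F \<subseteq> fin_configs}"

definition tempered :: "('g config \<Rightarrow> 'g config \<Rightarrow> real) \<Rightarrow> 'g config measure \<Rightarrow> bool" where
  "tempered D \<mu> \<longleftrightarrow>
     \<mu> \<in> space (prob_algebra config_space) \<and> D_integrable D \<mu> \<and>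
     (\<forall>n. bdd_above (D_transform D \<mu> ` {\<xi>. num_particles \<xi> \<le> enat n})) \<and>
     (\<forall>\<nu> \<in> space (prob_algebra config_space). D_integrable D \<nu> \<longrightarrow>
        ((\<forall>\<xi>\<in>fin_configs. D_transform D \<mu> \<xi> = D_transform D \<nu> \<xi>) \<longleftrightarrow> \<mu> = \<nu>)) \<and>
     D_span D \<subseteq> L2 \<mu> \<and>
     (\<forall>g\<in>L2 \<mu>. \<forall>\<epsilon>>0. \<exists>h\<in>D_span D. (\<integral>\<eta>. (g \<eta> - h \<eta>)\<^sup>2 \<partial>\<mu>) < \<epsilon>)"

text \<open>The path measures \<open>P \<eta>\<close> are only meaningful for \<open>\<eta> \<in> \<Gamma>\<close>, hence the integral over \<open>\<Gamma>\<close>.\<close>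

definition invariant_measure :: "'g config set \<Rightarrow>
    ('g config \<Rightarrow> (real \<Rightarrow> 'g config) measure) \<Rightarrow> 'g config measure \<Rightarrow> bool" where
  "invariant_measure \<Gamma> P \<mu> \<longleftrightarrow>
     \<mu> \<in> space (prob_algebra config_space) \<and> (AE \<eta> in \<mu>. \<eta> \<in> \<Gamma>) \<and>
     (\<forall>t\<ge>0. \<forall>f \<in> borel_measurable config_space. bounded (range f) \<longrightarrow>
        (LINT \<eta>:\<Gamma>|\<mu>. semigroup_op P t f \<eta>) = (\<integral>\<eta>. f \<eta> \<partial>\<mu>))"

definition ergodic_measure :: "'g config set \<Rightarrow>
    ('g config \<Rightarrow> (real \<Rightarrow> 'g config) measure) \<Rightarrow> 'g config measure \<Rightarrow> bool" where
  "ergodic_measure \<Gamma> P \<mu> \<longleftrightarrow> invariant_measure \<Gamma> P \<mu> \<and>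
     (\<forall>f\<in>L2 \<mu>. (\<forall>t\<ge>0. AE \<eta> in \<mu>. semigroup_op P t f \<eta> = f \<eta>) \<longrightarrow>
        (AE \<eta> in \<mu>. f \<eta> = (\<integral>\<zeta>. f \<zeta> \<partial>\<mu>)))"

definition product_measure :: "'g config measure \<Rightarrow> bool" where
  "product_measure \<mu> \<longleftrightarrow> (\<exists>\<nu> :: 'g \<Rightarrow> nat measure.
     (\<forall>x. \<nu> x \<in> space (prob_algebra (count_space UNIV))) \<and> \<mu> = (\<Pi>\<^sub>M x\<in>UNIV. \<nu> x))"

end

theory Submission
  imports Defs
begin

text \<open>
Invariance and duality make the transform of an invariant measure a harmonic function of the dual
process (\<open>D_transform_harmonic\<close>). Temperedness makes it bounded on configurations with \<open>n\<close>
particles, and a bounded harmonic function of a process with successful couplings is constant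
(\<open>D_transform_constant\<close>). This is the function \<open>f\<close>.

For multiplicativity, consider the mixtures of the functions \<open>D \<zeta>\<close>, where \<open>\<zeta>\<close> is random with \<open>n\<close>
particles. They form a convex set which is bounded in \<open>L\<^sup>2(\<mu>)\<close>, because \<open>(D \<zeta>)\<^sup>2\<close> is dominated by
duality functions of at most \<open>2 * n\<close> particles (\<open>D_square_le\<close>). By duality the semigroup maps this
set into itself (\<open>semigroup_op_D_mixture\<close>), and it contracts the \<open>L\<^sup>2\<close> norm. Hence the element of
minimal norm in the closure of the set is fixed by the semigroup. Ergodicity forces it to be a
constant, and the constant is \<open>f n\<close>, so mixtures come arbitrarily close to \<open>f n\<close> in \<open>L\<^sup>2(\<mu>)\<close>
(\<open>mixtures_approach_constant\<close>). Now let such a mixture evolve and pair it with \<open>D \<xi>\<close>, where \<open>\<xi>\<close>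
has \<open>m\<close> particles. The pairing stays close to \<open>f m * f n\<close> for all times. On the other hand the dual
particles eventually avoid the support of \<open>\<xi>\<close>, and for disjoint supports \<open>D \<xi> \<cdot> D \<zeta> = D (\<xi> + \<zeta>)\<close>, so
the pairing tends to \<open>f (m + n)\<close> (\<open>D_mixture_evolution_decorrelates\<close>). Therefore
\<open>f (m + n) = f m * f n\<close>.

Finally \<open>f n = f 1 ^ n\<close> says that the transform of \<open>\<mu>\<close> is that of the product of its one-site
marginals, and a tempered measure is determined by its transform (\<open>product_measureI\<close>).
\<close>

section \<open>Square-integrable functions and discrete mixtures\<close>

lemma (in prob_space) square_expectation_le_nn_integral_square:
  fixes X :: "'a \<Rightarrow> real"
  assumes [measurable]: "X \<in> borel_measurable M"
  shows "ennreal ((\<integral>x. X x \<partial>M)\<^sup>2) \<le> (\<integral>\<^sup>+x. ennreal ((X x)\<^sup>2) \<partial>M)"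
proof (cases "(\<integral>\<^sup>+x. ennreal ((X x)\<^sup>2) \<partial>M) = \<infinity>")
  case False
  then have sq: "integrable M (\<lambda>x. (X x)\<^sup>2)"
    by (intro integrableI_bounded) (auto simp: top.not_eq_extremum)
  then have "integrable M X"
    by (rule square_integrable_imp_integrable[rotated]) simp
  then have "variance X = (\<integral>x. (X x)\<^sup>2 \<partial>M) - (\<integral>x. X x \<partial>M)\<^sup>2"
    using sq by (rule variance_eq)
  moreover have "0 \<le> variance X" by (rule variance_positive)
  ultimately have "(\<integral>x. X x \<partial>M)\<^sup>2 \<le> (\<integral>x. (X x)\<^sup>2 \<partial>M)" by simp
  then show ?thesis
    using sq by (simp add: nn_integral_eq_integral ennreal_leI)
qed simp

lemma nn_integral_pmf_count_space:
  "(\<integral>\<^sup>+x. f x \<partial>measure_pmf p) = (\<integral>\<^sup>+x. ennreal (pmf p x) * f x \<partial>count_space (set_pmf p))"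
  unfolding nn_integral_measure_pmf
  by (rule nn_integral_count_space_eq) (auto simp: set_pmf_iff)

text \<open>A \<open>pmf\<close> lives on the discrete \<open>\<sigma>\<close>-algebra of a type that may be uncountable, where joint
measurability fails. Its support is countable, however, so measurability and the interchange of
integrals reduce to sums over the support.\<close>

lemma measurable_nn_integral_pmf:
  fixes F :: "'b \<Rightarrow> 'a \<Rightarrow> ennreal"
  assumes "\<And>x. x \<in> set_pmf p \<Longrightarrow> F x \<in> borel_measurable M"
  shows "(\<lambda>y. \<integral>\<^sup>+x. F x y \<partial>measure_pmf p) \<in> borel_measurable M"
proof -
  interpret sigma_finite_measure "count_space (set_pmf p)"
    by (rule sigma_finite_measure_count_space_countable) simp
  have "(\<lambda>(y, x). ennreal (pmf p x) * F x y) \<in> borel_measurable (M \<Otimes>\<^sub>M count_space (set_pmf p))"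
    using assms
    by (subst measurable_pair_swap_iff, intro measurable_pair_measure_countable1)
       (auto intro!: borel_measurable_times)
  then have "(\<lambda>y. \<integral>\<^sup>+x. ennreal (pmf p x) * F x y \<partial>count_space (set_pmf p)) \<in> borel_measurable M"
    by (rule borel_measurable_nn_integral)
  then show ?thesis unfolding nn_integral_pmf_count_space .
qed

lemma nn_integral_pmf_swap:
  fixes F :: "'b \<Rightarrow> 'a \<Rightarrow> ennreal"
  assumes "\<And>x. x \<in> set_pmf p \<Longrightarrow> F x \<in> borel_measurable M"
  shows "(\<integral>\<^sup>+y. \<integral>\<^sup>+x. F x y \<partial>measure_pmf p \<partial>M) = (\<integral>\<^sup>+x. \<integral>\<^sup>+y. F x y \<partial>M \<partial>measure_pmf p)"
  unfolding nn_integral_pmf_count_space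
  using assms
  by (subst nn_integral_count_space_nn_integral) 
     (auto simp: nn_integral_cmult intro!: nn_integral_cong)

text \<open>Completeness of \<open>L\<^sup>2\<close> in the form needed below. A Cauchy sequence with geometric rate has
increments whose \<open>L\<^sup>1\<close> norms are summable, so it converges almost everywhere; Fatou's lemma
carries the rate over to the limit.\<close>

lemma (in prob_space) L2_limit_of_fast_Cauchy:
  fixes u :: "nat \<Rightarrow> 'a \<Rightarrow> real"
  assumes [measurable]: "\<And>k. u k \<in> borel_measurable M"
    and C: "0 \<le> C"
    and Cauchy: "\<And>k j. (\<integral>\<^sup>+x. ennreal ((u k x - u (k + j) x)\<^sup>2) \<partial>M) \<le> ennreal (C / 4 ^ k)"
  obtains g where "g \<in> borel_measurable M"
    and "\<And>k. (\<integral>\<^sup>+x. ennreal ((u k x - g x)\<^sup>2) \<partial>M) \<le> ennreal (C / 4 ^ k)"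
proof -
  define v where "v k x = u (Suc k) x - u k x" for k x
  have [measurable]: "v k \<in> borel_measurable M" for k unfolding v_def by simp
  have v: "(\<integral>\<^sup>+x. ennreal \<bar>v k x\<bar> \<partial>M) \<le> ennreal ((C + 1) * (1 / 2) ^ k)" for k
  proof -
    have pt: "\<bar>v k x\<bar> \<le> 2 ^ k * (v k x)\<^sup>2 + (1 / 2) ^ k" for x
    proof -
      \<comment> \<open>The weight \<open>2 ^ k\<close> balances the rate \<open>1 / 4 ^ k\<close> of the squares against a constant,
          so that both terms on the right are of order \<open>1 / 2 ^ k\<close> after integration.\<close>
      have "0 \<le> (2 ^ k * \<bar>v k x\<bar> - 1)\<^sup>2" by simp
      also have "\<dots> = 2 ^ k * (2 ^ k * (v k x)\<^sup>2 - 2 * \<bar>v k x\<bar> + (1 / 2) ^ k)"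
        by (simp add: power2_eq_square field_simps flip: power_mult_distrib)
      finally have "0 \<le> 2 ^ k * (v k x)\<^sup>2 - 2 * \<bar>v k x\<bar> + (1 / 2) ^ k"
        by (metis zero_le_mult_iff not_le zero_less_power zero_less_numeral)
      moreover have "0 \<le> \<bar>v k x\<bar>" by simp
      ultimately show ?thesis by linarith
    qed
    have "(\<integral>\<^sup>+x. ennreal \<bar>v k x\<bar> \<partial>M)
        \<le> (\<integral>\<^sup>+x. ennreal (2 ^ k) * ennreal ((v k x)\<^sup>2) + ennreal ((1 / 2) ^ k) \<partial>M)"
      using pt by (intro nn_integral_mono) (simp flip: ennreal_mult ennreal_plus add: ennreal_leI)
    also have "\<dots> = ennreal (2 ^ k) * (\<integral>\<^sup>+x. ennreal ((v k x)\<^sup>2) \<partial>M) + ennreal ((1 / 2) ^ k)"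
      by (subst nn_integral_add) (auto simp: nn_integral_cmult emeasure_space_1)
    also have "\<dots> \<le> ennreal (2 ^ k) * ennreal (C / 4 ^ k) + ennreal ((1 / 2) ^ k)"
      using Cauchy[of k 1] unfolding v_def by (intro add_right_mono mult_left_mono) (auto simp: power2_commute)
    also have "\<dots> = ennreal ((C + 1) * (1 / 2) ^ k)"
    proof -
      have "(2::real) ^ k * (C / 4 ^ k) + (1/2) ^ k = (C + 1) * (1/2) ^ k"
        by (simp add: field_simps flip: power_mult_distrib)
      then show ?thesis using C by (simp flip: ennreal_mult ennreal_plus)
    qed
    finally show ?thesis .
  qed
  have "(\<integral>\<^sup>+x. suminf (\<lambda>k. ennreal \<bar>v k x\<bar>) \<partial>M) = suminf (\<lambda>k. \<integral>\<^sup>+x. ennreal \<bar>v k x\<bar> \<partial>M)"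
    by (rule nn_integral_suminf) simp
  also have "\<dots> \<le> suminf (\<lambda>k. ennreal ((C + 1) * (1 / 2) ^ k))"
    using v by (intro suminf_le) auto
  also have "\<dots> = ennreal (suminf (\<lambda>k. (C + 1) * (1 / 2) ^ k))"
    using C by (intro suminf_ennreal2) (auto intro!: summable_mult)
  finally have "(\<integral>\<^sup>+x. suminf (\<lambda>k. ennreal \<bar>v k x\<bar>) \<partial>M) \<noteq> \<infinity>"
    by (auto simp: top_unique)
  then have "AE x in M. suminf (\<lambda>k. ennreal \<bar>v k x\<bar>) \<noteq> \<infinity>"
    by (intro nn_integral_PInf_AE) auto
  then have conv: "AE x in M. (\<lambda>k. u k x) \<longlonglongrightarrow> lim (\<lambda>k. u k x)"
  proof eventually_elim
    case (elim x)
    then have "summable (\<lambda>k. \<bar>v k x\<bar>)"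
      by (intro summable_suminf_not_top) auto
    then have "summable (\<lambda>k. v k x)" by (rule summable_rabs_cancel)
    then have "convergent (\<lambda>n. u n x - u 0 x)"
      using sum_lessThan_telescope[of "\<lambda>k. u k x"] by (simp add: summable_iff_convergent v_def)
    then have "convergent (\<lambda>n. u n x - u 0 x + u 0 x)"
      by (intro convergent_add convergent_const)
    then show ?case by (simp add: convergent_LIMSEQ_iff)
  qed
  define g where "g x = lim (\<lambda>k. u k x)" for x
  show ?thesis
  proof
    show [measurable]: "g \<in> borel_measurable M"
      unfolding g_def by (rule borel_measurable_lim_metric) simp
    fix k
    have "(\<integral>\<^sup>+x. ennreal ((u k x - g x)\<^sup>2) \<partial>M)
        = (\<integral>\<^sup>+x. liminf (\<lambda>j. ennreal ((u k x - u (k + j) x)\<^sup>2)) \<partial>M)"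
      using conv
    proof (intro nn_integral_cong_AE, eventually_elim)
      case (elim x)
      from elim(2) have "(\<lambda>j. u (j + k) x) \<longlonglongrightarrow> g x"
        unfolding g_def by (rule LIMSEQ_ignore_initial_segment)
      then have "(\<lambda>j. ennreal ((u k x - u (k + j) x)\<^sup>2)) \<longlonglongrightarrow> ennreal ((u k x - g x)\<^sup>2)"
        by (intro tendsto_ennrealI tendsto_power tendsto_diff tendsto_const) (simp add: add.commute)
      then show ?case
        by (rule lim_imp_Liminf[OF sequentially_bot, symmetric])
    qed
    also have "\<dots> \<le> liminf (\<lambda>j. \<integral>\<^sup>+x. ennreal ((u k x - u (k + j) x)\<^sup>2) \<partial>M)"
      by (rule nn_integral_liminf) simp
    also have "\<dots> \<le> ennreal (C / 4 ^ k)"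
      using Cauchy[of k] by (intro Liminf_le) auto
    finally show "(\<integral>\<^sup>+x. ennreal ((u k x - g x)\<^sup>2) \<partial>M) \<le> ennreal (C / 4 ^ k)" .
  qed
qed

section \<open>Finite configurations and their duality functions\<close>

lemma fin_configs_iff: "\<xi> \<in> fin_configs \<longleftrightarrow> finite {x. \<xi> x \<noteq> 0}"
proof (cases "finite {x. \<xi> x \<noteq> 0}")
  case True
  with num_particles_finite_support[OF this] show ?thesis by (simp add: fin_configs_def)
next
  case False
  with num_particles_infinite_support[OF this] show ?thesis by (simp add: fin_configs_def)
qed

lemma num_particles_superset:
  assumes "finite J" and "{x. \<xi> x \<noteq> 0} \<subseteq> J"
  shows "num_particles \<xi> = enat (\<Sum>x\<in>J. \<xi> x)"
proof -
  have "num_particles \<xi> = enat (\<Sum>x | \<xi> x \<noteq> 0. \<xi> x)"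
    using assms finite_subset by (intro num_particles_finite_support) blast
  also have "(\<Sum>x | \<xi> x \<noteq> 0. \<xi> x) = (\<Sum>x\<in>J. \<xi> x)"
    using assms by (intro sum.mono_neutral_left) auto
  finally show ?thesis .
qed

lemma n_configs_subset_fin_configs: "n_configs n \<subseteq> fin_configs"
  by (auto simp: n_configs_def fin_configs_def)

lemma finite_support_n_configs: "\<xi> \<in> n_configs n \<Longrightarrow> finite {x. \<xi> x \<noteq> 0}"
  using n_configs_subset_fin_configs fin_configs_iff by blast

lemma fin_configsE:
  assumes "\<xi> \<in> fin_configs"
  obtains n where "\<xi> \<in> n_configs n"
  using assms by (auto simp: n_configs_def fin_configs_def)

lemma countable_fin_configs: "countable (fin_configs :: ('g::countable) config set)"
proof (rule countable_subset)
  show "fin_configs \<subseteq> range (\<lambda>xs::'g list. \<lambda>x. count_list xs x)"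
  proof
    fix \<xi> :: "'g config" assume "\<xi> \<in> fin_configs"
    then have fin: "finite {x. \<xi> x \<noteq> 0}" by (simp add: fin_configs_iff)
    then obtain ys where ys: "set ys = {x. \<xi> x \<noteq> 0}" "distinct ys"
      using finite_distinct_list by blast
    have rep: "count_list (replicate n y) x = (if x = y then n else 0)" for n :: nat and y x :: 'g
      by (induction n) auto
    have cl: "count_list (concat (map (\<lambda>y. replicate (\<xi> y) y) zs)) x = (if x \<in> set zs then \<xi> x else 0)"
      if "distinct zs" for zs x
      using that by (induction zs) (auto simp: rep)
    have "\<xi> = (\<lambda>x. count_list (concat (map (\<lambda>y. replicate (\<xi> y) y) ys)) x)"
      using cl[OF ys(2)] ys(1) by auto
    then show "\<xi> \<in> range (\<lambda>xs. \<lambda>x. count_list xs x)" by blast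
  qed
qed simp

lemma single_site_in_n_configs: "(\<lambda>y. if y = x then n else 0) \<in> n_configs n"
proof -
  have "{y. (if y = x then n else 0) \<noteq> 0} \<subseteq> {x}" by auto
  from num_particles_superset[OF _ this] show ?thesis by (simp add: n_configs_def)
qed

lemma add_in_n_configs:
  assumes "\<xi> \<in> n_configs n" and "\<xi>' \<in> n_configs m"
  shows "(\<lambda>x. \<xi> x + \<xi>' x) \<in> n_configs (n + m)"
proof -
  let ?J = "{x. \<xi> x \<noteq> 0} \<union> {x. \<xi>' x \<noteq> 0}"
  have fin: "finite ?J"
    using assms by (intro finite_UnI finite_support_n_configs)
  have "num_particles \<xi> = enat (sum \<xi> ?J)" "num_particles \<xi>' = enat (sum \<xi>' ?J)"
    "num_particles (\<lambda>x. \<xi> x + \<xi>' x) = enat (\<Sum>x\<in>?J. \<xi> x + \<xi>' x)"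
    by (rule num_particles_superset[OF fin], force)+
  then show ?thesis
    using assms by (simp add: n_configs_def sum.distrib)
qed

context dual_config_process
begin

lemma D_prod:
  assumes "finite J" and "{x. \<xi> x \<noteq> 0} \<subseteq> J"
  shows "D \<xi> \<eta> = (\<Prod>x\<in>J. d (\<xi> x) (\<eta> x))"
proof -
  have "\<xi> \<in> fin_configs"
    using assms finite_subset by (auto simp: fin_configs_iff)
  moreover have "d (\<xi> x) (\<eta> x) = 1" if "x \<notin> J" for x
    using that assms(2) by (cases "\<xi> x = 0") (auto simp: d_zero)
  then have "{x. d (\<xi> x) (\<eta> x) \<noteq> 1} \<subseteq> J" by blast
  ultimately show ?thesis
    using assms(1) by (simp add: D_factorized Prod_any.expand_superset)
qed

lemma D_mult_disjoint:
  assumes "\<xi> \<in> fin_configs" and "\<xi>' \<in> fin_configs" and "disjoint_supp \<xi> \<xi>'"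
  shows "D \<xi> \<eta> * D \<xi>' \<eta> = D (\<lambda>x. \<xi> x + \<xi>' x) \<eta>"
proof -
  let ?J = "{x. \<xi> x \<noteq> 0} \<union> {x. \<xi>' x \<noteq> 0}"
  have fin: "finite ?J" using assms by (simp add: fin_configs_iff)
  have "D \<xi> \<eta> * D \<xi>' \<eta> = (\<Prod>x\<in>?J. d (\<xi> x) (\<eta> x) * d (\<xi>' x) (\<eta> x))"
  proof -
    have "D \<xi> \<eta> = (\<Prod>x\<in>?J. d (\<xi> x) (\<eta> x))" "D \<xi>' \<eta> = (\<Prod>x\<in>?J. d (\<xi>' x) (\<eta> x))"
      by (rule D_prod[OF fin], force)+
    then show ?thesis by (simp add: prod.distrib)
  qed
  also have "\<dots> = (\<Prod>x\<in>?J. d (\<xi> x + \<xi>' x) (\<eta> x))"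
  proof (intro prod.cong refl)
    fix x
    have "\<xi> x = 0 \<or> \<xi>' x = 0" using assms(3) by (auto simp: disjoint_supp_def)
    then show "d (\<xi> x) (\<eta> x) * d (\<xi>' x) (\<eta> x) = d (\<xi> x + \<xi>' x) (\<eta> x)"
      by (auto simp: d_zero)
  qed
  also have "\<dots> = D (\<lambda>x. \<xi> x + \<xi>' x) \<eta>"
    using fin by (intro D_prod[symmetric]) auto
  finally show ?thesis .
qed

text \<open>The square of \<open>d k\<close> is a polynomial of degree \<open>2 * k\<close>, hence in the span of \<open>d 0, \<dots>, d (2 * k)\<close>.
Taking the sum of the absolute values of the coefficients as common constant turns the linear
combination into an upper bound.\<close>

lemma d_square_le:
  "\<exists>a\<ge>0. \<forall>j. (d k j)\<^sup>2 \<le> a * (\<Sum>r\<le>2 * k. d r j)"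
proof -
  obtain p :: "real poly" where p: "degree p = k" "\<And>j. d k j = poly p (real j)"
    using d_poly by blast
  have "degree (p ^ 2) = 2 * k"
    using p(1) by (cases "p = 0") (auto simp: degree_power_eq)
  then obtain c where c: "\<And>j. poly (p ^ 2) (real j) = (\<Sum>r\<le>2 * k. c r * d r j)"
    using d_spans by blast
  let ?a = "\<Sum>r\<le>2 * k. \<bar>c r\<bar>"
  have "(d k j)\<^sup>2 \<le> ?a * (\<Sum>r\<le>2 * k. d r j)" for j
  proof -
    have "(d k j)\<^sup>2 = (\<Sum>r\<le>2 * k. c r * d r j)"
      using c[of j] by (simp add: p(2))
    also have "\<dots> \<le> (\<Sum>r\<le>2 * k. ?a * d r j)"
    proof (intro sum_mono mult_right_mono d_nonneg)
      fix r assume "r \<in> {..2 * k}"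
      then have "\<bar>c r\<bar> \<le> ?a" by (intro member_le_sum) auto
      then show "c r \<le> ?a" by linarith
    qed
    finally show ?thesis by (simp add: sum_distrib_left)
  qed
  then show ?thesis by (intro exI[of _ ?a]) (simp add: sum_nonneg)
qed

text \<open>Multiplying the one-site bounds over the at most \<open>n\<close> occupied sites and expanding the product of
sums bounds \<open>(D \<xi>)\<^sup>2\<close> by duality functions of configurations with at most \<open>2 * n\<close> particles. What
matters is that the constant and the number of terms depend on \<open>n\<close> only: temperedness then bounds
\<open>D \<xi>\<close> in \<open>L\<^sup>2\<close> uniformly over all \<open>\<xi>\<close> with \<open>n\<close> particles.\<close>

lemma D_square_le:
  "\<exists>a\<ge>0. \<forall>\<xi>\<in>n_configs n. \<exists>R. finite R \<and> card R \<le> (2 * n + 1) ^ n \<and>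
     R \<subseteq> {\<rho>. num_particles \<rho> \<le> enat (2 * n)} \<and>
     (\<forall>\<eta>. (D \<xi> \<eta>)\<^sup>2 \<le> a * (\<Sum>\<rho>\<in>R. D \<rho> \<eta>))"
proof -
  obtain b where b: "\<And>k. b k \<ge> 0" "\<And>k j. (d k j)\<^sup>2 \<le> b k * (\<Sum>r\<le>2 * k. d r j)"
    using d_square_le by metis
  define a where "a = 1 + (\<Sum>k\<le>n. b k)"
  have a1: "a \<ge> 1" unfolding a_def using b(1) by (simp add: sum_nonneg)
  have ba: "b k \<le> a" if "k \<le> n" for k
    unfolding a_def using member_le_sum[of k "{..n}" b] that b(1) by auto
  have "\<exists>R. finite R \<and> card R \<le> (2 * n + 1) ^ n \<and>
     R \<subseteq> {\<rho>. num_particles \<rho> \<le> enat (2 * n)} \<and>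
     (\<forall>\<eta>. (D \<xi> \<eta>)\<^sup>2 \<le> a ^ n * (\<Sum>\<rho>\<in>R. D \<rho> \<eta>))" if \<xi>: "\<xi> \<in> n_configs n" for \<xi>
  proof -
    define J where "J = {x. \<xi> x \<noteq> 0}"
    have fin: "finite J"
      using \<xi> unfolding J_def by (rule finite_support_n_configs)
    have sumJ: "sum \<xi> J = n"
      using \<xi> num_particles_superset[of J \<xi>] fin by (simp add: n_configs_def J_def)
    have le_n: "\<xi> x \<le> n" if "x \<in> J" for x
      using member_le_sum[of x J \<xi>] that fin sumJ by simp
    have cardJ: "card J \<le> n"
    proof -
      have "card J = (\<Sum>x\<in>J. 1)" by simp
      also have "\<dots> \<le> sum \<xi> J" by (intro sum_mono) (auto simp: J_def)
      finally show ?thesis using sumJ by simp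
    qed
    define S where "S = PiE J (\<lambda>x. {..2 * \<xi> x})"
    define e where "e \<rho> = (\<lambda>x. if x \<in> J then \<rho> x else 0 :: nat)" for \<rho>
    have finS: "finite S" unfolding S_def using fin by (intro finite_PiE) auto
    have e_supp: "{x. e \<rho> x \<noteq> 0} \<subseteq> J" for \<rho> by (auto simp: e_def)
    have inj: "inj_on e S"
    proof (rule inj_onI)
      fix \<rho> \<rho>' assume \<rho>: "\<rho> \<in> S" "\<rho>' \<in> S" "e \<rho> = e \<rho>'"
      then have "\<rho> x = \<rho>' x" if "x \<in> J" for x
        using that by (metis e_def)
      with \<rho> show "\<rho> = \<rho>'" unfolding S_def by (intro PiE_ext) auto
    qed
    have cardR: "card (e ` S) \<le> (2 * n + 1) ^ n"
    proof -
      have "card (e ` S) \<le> card S" using finS by (rule card_image_le)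
      also have "\<dots> = (\<Prod>x\<in>J. 2 * \<xi> x + 1)" unfolding S_def using fin by (simp add: card_PiE)
      also have "\<dots> \<le> (\<Prod>x\<in>J. 2 * n + 1)" using le_n by (intro prod_mono) auto
      also have "\<dots> = (2 * n + 1) ^ card J" by simp
      also have "\<dots> \<le> (2 * n + 1) ^ n" using cardJ by (intro power_increasing) auto
      finally show ?thesis .
    qed
    have R: "num_particles (e \<rho>) \<le> enat (2 * n)" if "\<rho> \<in> S" for \<rho>
    proof -
      have "sum (e \<rho>) J \<le> (\<Sum>x\<in>J. 2 * \<xi> x)"
        using that by (intro sum_mono) (auto simp: e_def S_def PiE_iff)
      also have "\<dots> = 2 * n" using sumJ by (simp flip: sum_distrib_left)
      finally show ?thesis using num_particles_superset[OF fin e_supp] by simp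
    qed
    have "(D \<xi> \<eta>)\<^sup>2 \<le> a ^ n * (\<Sum>\<rho>\<in>e ` S. D \<rho> \<eta>)" for \<eta>
    proof -
      have "(D \<xi> \<eta>)\<^sup>2 = (\<Prod>x\<in>J. (d (\<xi> x) (\<eta> x))\<^sup>2)"
        using fin D_prod[of J \<xi> \<eta>] by (simp add: J_def prod_power_distrib)
      also have "\<dots> \<le> (\<Prod>x\<in>J. a * (\<Sum>r\<le>2 * \<xi> x. d r (\<eta> x)))"
      proof (intro prod_mono conjI)
        fix x assume "x \<in> J"
        then have "b (\<xi> x) \<le> a" using ba le_n by simp
        then show "(d (\<xi> x) (\<eta> x))\<^sup>2 \<le> a * (\<Sum>r\<le>2 * \<xi> x. d r (\<eta> x))"
          by (intro order.trans[OF b(2)] mult_right_mono sum_nonneg d_nonneg)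
      qed simp
      also have "\<dots> = a ^ card J * (\<Prod>x\<in>J. \<Sum>r\<le>2 * \<xi> x. d r (\<eta> x))"
        by (simp add: prod.distrib)
      also have "\<dots> \<le> a ^ n * (\<Prod>x\<in>J. \<Sum>r\<le>2 * \<xi> x. d r (\<eta> x))"
        using a1 cardJ by (intro mult_right_mono power_increasing prod_nonneg sum_nonneg ballI d_nonneg) auto
      also have "(\<Prod>x\<in>J. \<Sum>r\<le>2 * \<xi> x. d r (\<eta> x)) = (\<Sum>\<rho>\<in>S. \<Prod>x\<in>J. d (\<rho> x) (\<eta> x))"
        unfolding S_def using fin by (subst prod_sum_PiE) auto
      also have "\<dots> = (\<Sum>\<rho>\<in>S. D (e \<rho>) \<eta>)"
      proof (intro sum.cong refl)
        fix \<rho>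
        show "(\<Prod>x\<in>J. d (\<rho> x) (\<eta> x)) = D (e \<rho>) \<eta>"
          unfolding D_prod[OF fin e_supp] by (simp add: e_def)
      qed
      also have "\<dots> = (\<Sum>\<rho>\<in>e ` S. D \<rho> \<eta>)"
        by (simp add: sum.reindex[OF inj])
      finally show ?thesis .
    qed
    then show ?thesis
      using finS cardR R by (intro exI[of _ "e ` S"]) auto
  qed
  then show ?thesis using a1 by (intro exI[of _ "a ^ n"]) auto
qed

end

section \<open>The semigroup of a Markov process with an invariant measure\<close>

context markov_process
begin

definition trans :: "real \<Rightarrow> 's \<Rightarrow> 's measure" where
  "trans t x = distr (P x) E (\<lambda>\<omega>. \<omega> t)"

lemma measurable_coordinate:
  assumes "0 \<le> t"
  shows "(\<lambda>\<omega>. \<omega> t) \<in> path_space E W \<rightarrow>\<^sub>M E"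
  unfolding path_space_def
  using assms by (intro measurable_restrict_space1 measurable_component_singleton) simp

lemma P_in_prob_algebra: "x \<in> space E \<Longrightarrow> P x \<in> space (prob_algebra (path_space E W))"
  using kernel by (rule measurable_space)

lemma prob_space_P: "x \<in> space E \<Longrightarrow> prob_space (P x)"
  using P_in_prob_algebra by (auto simp: space_prob_algebra)

lemma sets_P: "x \<in> space E \<Longrightarrow> sets (P x) = sets (path_space E W)"
  using P_in_prob_algebra by (auto simp: space_prob_algebra)

lemma measurable_coordinate_P:
  assumes "x \<in> space E" and "0 \<le> t"
  shows "(\<lambda>\<omega>. \<omega> t) \<in> P x \<rightarrow>\<^sub>M E"
  using measurable_coordinate[OF assms(2)] sets_P[OF assms(1)] by (simp cong: measurable_cong_sets)

lemma trans_kernel: "0 \<le> t \<Longrightarrow> trans t \<in> E \<rightarrow>\<^sub>M prob_algebra E"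
  unfolding trans_def
  by (intro measurable_compose[OF kernel] measurable_distr_prob_space measurable_coordinate)

lemma sets_trans [simp]: "sets (trans t x) = sets E"
  by (simp add: trans_def)

lemma prob_space_trans: "\<lbrakk>x \<in> space E; 0 \<le> t\<rbrakk> \<Longrightarrow> prob_space (trans t x)"
  unfolding trans_def
  by (intro prob_space.prob_space_distr prob_space_P measurable_coordinate_P)

lemma nn_integral_trans:
  assumes "x \<in> space E" and "0 \<le> t" and "f \<in> borel_measurable E"
  shows "(\<integral>\<^sup>+y. f y \<partial>trans t x) = (\<integral>\<^sup>+\<omega>. f (\<omega> t) \<partial>P x)"
  unfolding trans_def using assms by (intro nn_integral_distr measurable_coordinate_P) auto

lemma semigroup_op_eq_trans:
  assumes "x \<in> space E" and "0 \<le> t" and "f \<in> borel_measurable E"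
  shows "semigroup_op P t f x = (\<integral>y. f y \<partial>trans t x)"
  unfolding trans_def semigroup_op_def
  using assms by (intro integral_distr[symmetric] measurable_coordinate_P) auto

lemma borel_measurable_semigroup_op:
  assumes "0 \<le> t" and [measurable]: "f \<in> borel_measurable E"
  shows "semigroup_op P t f \<in> borel_measurable E"
proof -
  have "(\<lambda>x. \<integral>y. f y \<partial>trans t x) \<in> borel_measurable E"
    by (rule measurable_compose[OF measurable_prob_algebraD[OF trans_kernel[OF assms(1)]]]) measurable
  then show ?thesis
    by (rule measurable_cong[THEN iffD1, rotated]) (simp add: semigroup_op_eq_trans assms)
qed

lemma nn_integral_invariant:
  assumes "sets m = sets E" and "0 \<le> t" and "m \<bind> trans t = m" and "f \<in> borel_measurable E"
  shows "(\<integral>\<^sup>+x. \<integral>\<^sup>+y. f y \<partial>trans t x \<partial>m) = (\<integral>\<^sup>+x. f x \<partial>m)"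
proof -
  have "trans t \<in> m \<rightarrow>\<^sub>M subprob_algebra E"
    using measurable_prob_algebraD[OF trans_kernel[OF assms(2)]] assms(1)
    by (simp cong: measurable_cong_sets)
  from nn_integral_bind[OF assms(4) this] assms(3) show ?thesis by simp
qed

lemma semigroup_op_L2_contraction:
  assumes m: "sets m = sets E" and t: "0 \<le> t" and inv: "m \<bind> trans t = m"
    and [measurable]: "u \<in> borel_measurable E"
  shows "(\<integral>\<^sup>+x. ennreal ((semigroup_op P t u x)\<^sup>2) \<partial>m) \<le> (\<integral>\<^sup>+x. ennreal ((u x)\<^sup>2) \<partial>m)"
proof -
  have "(\<integral>\<^sup>+x. ennreal ((semigroup_op P t u x)\<^sup>2) \<partial>m)
      \<le> (\<integral>\<^sup>+x. \<integral>\<^sup>+y. ennreal ((u y)\<^sup>2) \<partial>trans t x \<partial>m)"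
  proof (rule nn_integral_mono)
    fix x assume "x \<in> space m"
    then have x: "x \<in> space E" using sets_eq_imp_space_eq[OF m] by simp
    interpret prob_space "trans t x" using x t by (rule prob_space_trans)
    have "u \<in> borel_measurable (trans t x)" by (simp cong: measurable_cong_sets)
    from square_expectation_le_nn_integral_square[OF this]
    show "ennreal ((semigroup_op P t u x)\<^sup>2) \<le> (\<integral>\<^sup>+y. ennreal ((u y)\<^sup>2) \<partial>trans t x)"
      using x t by (simp add: semigroup_op_eq_trans)
  qed
  also have "\<dots> = (\<integral>\<^sup>+x. ennreal ((u x)\<^sup>2) \<partial>m)"
    by (rule nn_integral_invariant[OF m t inv]) simp
  finally show ?thesis .
qed

text \<open>The integrals defining the semigroup may diverge at some starting points, where their value is the
default 0 and additivity breaks down. For square-integrable functions invariance confines this to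
a null set.\<close>

lemma semigroup_op_diff_AE:
  assumes m: "sets m = sets E" and t: "0 \<le> t" and inv: "m \<bind> trans t = m"
    and [measurable]: "u \<in> borel_measurable E" "v \<in> borel_measurable E"
    and u: "(\<integral>\<^sup>+x. ennreal ((u x)\<^sup>2) \<partial>m) < \<infinity>" and v: "(\<integral>\<^sup>+x. ennreal ((v x)\<^sup>2) \<partial>m) < \<infinity>"
  shows "AE x in m. semigroup_op P t (\<lambda>y. u y - v y) x = semigroup_op P t u x - semigroup_op P t v x"
proof -
  have int: "AE x in m. integrable (trans t x) w"
    if [measurable]: "w \<in> borel_measurable E" and w: "(\<integral>\<^sup>+x. ennreal ((w x)\<^sup>2) \<partial>m) < \<infinity>" for w
  proof -
    have "(\<integral>\<^sup>+x. \<integral>\<^sup>+y. ennreal ((w y)\<^sup>2) \<partial>trans t x \<partial>m) \<noteq> \<infinity>"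
      using w by (subst nn_integral_invariant[OF m t inv]) auto
    moreover have "(\<lambda>x. \<integral>\<^sup>+y. ennreal ((w y)\<^sup>2) \<partial>trans t x) \<in> borel_measurable E"
      by (rule measurable_compose[OF measurable_prob_algebraD[OF trans_kernel[OF t]]]) measurable
    then have "(\<lambda>x. \<integral>\<^sup>+y. ennreal ((w y)\<^sup>2) \<partial>trans t x) \<in> borel_measurable m"
      using m by (simp cong: measurable_cong_sets)
    ultimately have "AE x in m. (\<integral>\<^sup>+y. ennreal ((w y)\<^sup>2) \<partial>trans t x) \<noteq> \<infinity>"
      by (rule nn_integral_PInf_AE[rotated])
    then show ?thesis
    proof (rule AE_mp, intro AE_I2 impI)
      fix x assume "x \<in> space m" and fin: "(\<integral>\<^sup>+y. ennreal ((w y)\<^sup>2) \<partial>trans t x) \<noteq> \<infinity>"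
      then have x: "x \<in> space E" using sets_eq_imp_space_eq[OF m] by simp
      interpret prob_space "trans t x" using x t by (rule prob_space_trans)
      have w: "w \<in> borel_measurable (trans t x)" by (simp cong: measurable_cong_sets)
      then have "integrable (trans t x) (\<lambda>y. (w y)\<^sup>2)"
        using fin by (intro integrableI_bounded) (auto simp: top.not_eq_extremum)
      with w show "integrable (trans t x) w" by (rule square_integrable_imp_integrable)
    qed
  qed
  have "AE x in m. x \<in> space E"
    using sets_eq_imp_space_eq[OF m] by (auto intro: AE_I2)
  with int[OF \<open>u \<in> borel_measurable E\<close> u] int[OF \<open>v \<in> borel_measurable E\<close> v] show ?thesis
  proof eventually_elim
    case (elim x)
    then show ?case using t by (simp add: semigroup_op_eq_trans)
  qed
qed

end

lemma
  assumes "sets m = sets M" and "A \<in> sets M" and "AE x in m. x \<in> A"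
  shows nn_integral_restrict_full: "(\<integral>\<^sup>+x. f x \<partial>restrict_space m A) = (\<integral>\<^sup>+x. f x \<partial>m)"
    and AE_restrict_full: "(AE x in restrict_space m A. Q x) \<longleftrightarrow> (AE x in m. Q x)"
proof -
  have A: "A \<inter> space m \<in> sets m" using assms by auto
  show "(\<integral>\<^sup>+x. f x \<partial>restrict_space m A) = (\<integral>\<^sup>+x. f x \<partial>m)"
    unfolding nn_integral_restrict_space[OF A]
    using assms(3) by (intro nn_integral_cong_AE) (auto elim: eventually_mono)
  show "(AE x in restrict_space m A. Q x) \<longleftrightarrow> (AE x in m. Q x)"
    unfolding AE_restrict_space_iff[OF A]
    using assms(3) by (auto elim: eventually_elim2 AE_mp)
qed

section \<open>The dual process at a fixed time\<close>

context dual_config_process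
begin

text \<open>There are only countably many finite configurations, so the law of the dual process at a fixed time
is a \<open>pmf\<close>; this makes it possible to average over starting points with \<open>bind_pmf\<close>.\<close>

definition dual_law :: "real \<Rightarrow> 'g config \<Rightarrow> 'g config pmf" where
  "dual_law t \<xi> = Abs_pmf (distr (Pd \<xi>) (count_space UNIV) (\<lambda>\<omega>. \<omega> t))"

lemma measurable_dual_coordinate:
  assumes "\<xi> \<in> fin_configs" and "0 \<le> t"
  shows "(\<lambda>\<omega>. \<omega> t) \<in> Pd \<xi> \<rightarrow>\<^sub>M count_space UNIV"
  using assms by (intro measurable_compose[OF dual.measurable_coordinate_P]) auto

lemma measure_pmf_dual_law:
  assumes "\<xi> \<in> fin_configs" and "0 \<le> t"
  shows "measure_pmf (dual_law t \<xi>) = distr (Pd \<xi>) (count_space UNIV) (\<lambda>\<omega>. \<omega> t)"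
proof -
  let ?M = "distr (Pd \<xi>) (count_space UNIV) (\<lambda>\<omega>. \<omega> t)"
  note meas = measurable_dual_coordinate[OF assms]
  interpret Pd: prob_space "Pd \<xi>" using assms by (intro dual.prob_space_P) simp
  interpret M: prob_space ?M by (rule Pd.prob_space_distr[OF meas])
  have "AE \<omega> in Pd \<xi>. \<omega> t \<in> fin_configs"
    using measurable_space[OF dual.measurable_coordinate_P[of \<xi> t]] assms by (intro AE_I2) auto
  then have "AE \<zeta> in ?M. \<zeta> \<in> fin_configs"
    by (subst AE_distr_iff[OF meas]) auto
  then have "AE \<zeta> in ?M. measure ?M {\<zeta>} \<noteq> 0"
    using countable_fin_configs by (subst M.AE_support_countable) auto
  then show ?thesis
    unfolding dual_law_def using M.prob_space_axioms by (intro Abs_pmf_inverse) auto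
qed

lemma set_dual_law:
  assumes "\<xi> \<in> n_configs n" and "0 \<le> t"
  shows "set_pmf (dual_law t \<xi>) \<subseteq> n_configs n"
proof -
  have \<xi>: "\<xi> \<in> fin_configs" using assms n_configs_subset_fin_configs by blast
  have "AE \<zeta> in measure_pmf (dual_law t \<xi>). \<zeta> \<in> n_configs n"
    unfolding measure_pmf_dual_law[OF \<xi> assms(2)]
    using dual_conserved[OF \<xi> assms(2)] assms(1)
    by (subst AE_distr_iff[OF measurable_dual_coordinate[OF \<xi> assms(2)]]) (auto simp: n_configs_def)
  then show ?thesis by (auto simp: AE_measure_pmf_iff)
qed

lemma nn_integral_dual_law:
  assumes "\<xi> \<in> fin_configs" and "0 \<le> t"
  shows "(\<integral>\<^sup>+\<zeta>. f \<zeta> \<partial>dual_law t \<xi>) = (\<integral>\<^sup>+\<omega>. f (\<omega> t) \<partial>Pd \<xi>)"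
  unfolding measure_pmf_dual_law[OF assms]
  by (rule nn_integral_distr[OF measurable_dual_coordinate[OF assms]]) simp

lemma integral_dual_law:
  fixes f :: "_ \<Rightarrow> real"
  assumes "\<xi> \<in> fin_configs" and "0 \<le> t"
  shows "(\<integral>\<zeta>. f \<zeta> \<partial>dual_law t \<xi>) = (\<integral>\<omega>. f (\<omega> t) \<partial>Pd \<xi>)"
  unfolding measure_pmf_dual_law[OF assms]
  by (rule integral_distr[OF measurable_dual_coordinate[OF assms]]) simp

lemma dual_law_spreads:
  assumes "\<xi> \<in> fin_configs" and "\<xi>' \<in> fin_configs"
  shows "((\<lambda>t. measure_pmf.prob (dual_law t \<xi>) {\<zeta>. \<not> disjoint_supp \<zeta> \<xi>'}) \<longlongrightarrow> 0) at_top"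
proof -
  have "((\<lambda>t. 1 - measure (Pd \<xi>) {\<omega> \<in> space (Pd \<xi>). disjoint_supp (\<omega> t) \<xi>'}) \<longlongrightarrow> 1 - 1) at_top"
    by (intro tendsto_diff tendsto_const dual_spreads assms)
  moreover have "\<forall>\<^sub>F t in at_top. 1 - measure (Pd \<xi>) {\<omega> \<in> space (Pd \<xi>). disjoint_supp (\<omega> t) \<xi>'}
      = measure_pmf.prob (dual_law t \<xi>) {\<zeta>. \<not> disjoint_supp \<zeta> \<xi>'}"
    using eventually_ge_at_top[of 0]
  proof eventually_elim
    case (elim t)
    have "measure (Pd \<xi>) {\<omega> \<in> space (Pd \<xi>). disjoint_supp (\<omega> t) \<xi>'}
        = measure_pmf.prob (dual_law t \<xi>) {\<zeta>. disjoint_supp \<zeta> \<xi>'}"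
      unfolding measure_pmf_dual_law[OF assms(1) elim]
      by (subst measure_distr[OF measurable_dual_coordinate[OF assms(1) elim]])
         (auto intro!: arg_cong[where f="measure (Pd \<xi>)"])
    also have "\<dots> = 1 - measure_pmf.prob (dual_law t \<xi>) {\<zeta>. \<not> disjoint_supp \<zeta> \<xi>'}"
      using measure_pmf.prob_compl[of "{\<zeta>. \<not> disjoint_supp \<zeta> \<xi>'}" "dual_law t \<xi>"]
      by (simp add: Compl_eq_Diff_UNIV[symmetric] Collect_neg_eq[symmetric] )
    finally show ?case by simp
  qed
  ultimately show ?thesis by (auto intro: Lim_transform_eventually)
qed

end

section \<open>Tempered invariant measures\<close>

locale tempered_invariant_measure = dual_config_process \<Gamma> W P Wd Pd D d
  for \<Gamma> :: "('g::countable) config set" and W P Wd Pd D d +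
  fixes \<mu> :: "'g config measure"
  assumes tempered: "tempered D \<mu>"
    and invariant: "invariant_measure \<Gamma> P \<mu>"
begin

text \<open>The measure \<open>\<mu>\<close> is defined on all configurations, the transition kernels only on \<open>\<Gamma>\<close>;
the restriction turns \<open>\<mu>\<close> into a measure on the state space of the process without loss of mass.\<close>

abbreviation \<mu>\<^sub>\<Gamma> where "\<mu>\<^sub>\<Gamma> \<equiv> restrict_space \<mu> \<Gamma>"

lemma sets_\<mu>: "sets \<mu> = sets config_space" and prob_space_\<mu>: "prob_space \<mu>"
  using tempered by (auto simp: tempered_def space_prob_algebra)

sublocale \<mu>: prob_space \<mu> by (rule prob_space_\<mu>)

lemma AE_\<Gamma>: "AE \<eta> in \<mu>. \<eta> \<in> \<Gamma>"
  using invariant by (auto simp: invariant_measure_def)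

lemmas nn_integral_\<mu>\<^sub>\<Gamma> = nn_integral_restrict_full[OF sets_\<mu> state_space AE_\<Gamma>]
lemmas AE_\<mu>\<^sub>\<Gamma> = AE_restrict_full[OF sets_\<mu> state_space AE_\<Gamma>]

lemma sets_\<mu>\<^sub>\<Gamma>: "sets \<mu>\<^sub>\<Gamma> = sets (restrict_space config_space \<Gamma>)"
  by (rule sets_restrict_space_cong[OF sets_\<mu>])

lemma space_config_space: "space config_space = UNIV"
  by (simp add: config_space_def space_PiM)

lemma space_E [simp]: "space (restrict_space config_space \<Gamma>) = \<Gamma>"
  by (simp add: space_restrict_space space_config_space)

lemma borel_measurable_\<mu>: "borel_measurable \<mu> = borel_measurable config_space"
  by (rule measurable_cong_sets) (simp_all add: sets_\<mu>)

lemma borel_measurable_E: "f \<in> borel_measurable \<mu> \<Longrightarrow> f \<in> borel_measurable (restrict_space config_space \<Gamma>)"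
  unfolding borel_measurable_\<mu> by (rule measurable_restrict_space1)

lemma prob_space_\<mu>\<^sub>\<Gamma>: "prob_space \<mu>\<^sub>\<Gamma>"
  using nn_integral_\<mu>\<^sub>\<Gamma>[of "\<lambda>_. 1"] \<mu>.emeasure_space_1 by (intro prob_spaceI) simp

text \<open>Invariance is given for bounded functions; as an identity of measures on \<open>\<Gamma>\<close> it applies to all
non-negative measurable functions, in particular to the unbounded functions \<open>D \<xi>\<close>.\<close>

lemma bind_invariant:
  assumes t: "0 \<le> t"
  shows "\<mu>\<^sub>\<Gamma> \<bind> config.trans t = \<mu>\<^sub>\<Gamma>"
proof (rule measure_eqI)
  have kernel: "config.trans t \<in> \<mu>\<^sub>\<Gamma> \<rightarrow>\<^sub>M subprob_algebra (restrict_space config_space \<Gamma>)"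
    using measurable_prob_algebraD[OF config.trans_kernel[OF t]] sets_\<mu>\<^sub>\<Gamma>
    by (simp cong: measurable_cong_sets)
  have ne: "space \<mu>\<^sub>\<Gamma> \<noteq> {}" by (rule prob_space.not_empty[OF prob_space_\<mu>\<^sub>\<Gamma>])
  show sets: "sets (\<mu>\<^sub>\<Gamma> \<bind> config.trans t) = sets \<mu>\<^sub>\<Gamma>"
    using ne by (subst sets_bind) (auto simp: sets_\<mu>\<^sub>\<Gamma>)
  fix A assume "A \<in> sets (\<mu>\<^sub>\<Gamma> \<bind> config.trans t)"
  then have A: "A \<in> sets (restrict_space config_space \<Gamma>)" using sets sets_\<mu>\<^sub>\<Gamma> by simp
  then have A': "A \<in> sets config_space" and sub: "A \<subseteq> \<Gamma>"
    using state_space space_config_space by (auto simp: sets_restrict_space_iff)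
  have iE: "indicator A \<in> borel_measurable (restrict_space config_space \<Gamma>)" using A by simp
  have op: "semigroup_op P t (indicator A) \<eta> = measure (config.trans t \<eta>) A" if "\<eta> \<in> \<Gamma>" for \<eta>
    using that t A by (subst config.semigroup_op_eq_trans) auto
  have "emeasure (\<mu>\<^sub>\<Gamma> \<bind> config.trans t) A = (\<integral>\<^sup>+\<eta>. emeasure (config.trans t \<eta>) A \<partial>\<mu>\<^sub>\<Gamma>)"
    using ne kernel A by (rule emeasure_bind)
  also have "\<dots> = (\<integral>\<^sup>+\<eta>. ennreal (semigroup_op P t (indicator A) \<eta>) \<partial>\<mu>\<^sub>\<Gamma>)"
  proof (rule nn_integral_cong)
    fix \<eta> assume "\<eta> \<in> space \<mu>\<^sub>\<Gamma>"
    then have \<eta>: "\<eta> \<in> \<Gamma>" by (simp add: space_restrict_space)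
    interpret tr: prob_space "config.trans t \<eta>" using \<eta> t by (intro config.prob_space_trans) simp_all
    show "emeasure (config.trans t \<eta>) A = ennreal (semigroup_op P t (indicator A) \<eta>)"
      by (simp add: op[OF \<eta>] tr.emeasure_eq_measure)
  qed
  also have "\<dots> = ennreal (\<integral>\<eta>. semigroup_op P t (indicator A) \<eta> \<partial>\<mu>\<^sub>\<Gamma>)"
  proof (rule nn_integral_eq_integral)
    interpret R: prob_space \<mu>\<^sub>\<Gamma> by (rule prob_space_\<mu>\<^sub>\<Gamma>)
    have "semigroup_op P t (indicator A) \<in> borel_measurable \<mu>\<^sub>\<Gamma>"
      using config.borel_measurable_semigroup_op[OF t iE] sets_\<mu>\<^sub>\<Gamma> by (simp cong: measurable_cong_sets)
    moreover have "AE \<eta> in \<mu>\<^sub>\<Gamma>. norm (semigroup_op P t (indicator A) \<eta>) \<le> 1"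
    proof (rule AE_I2)
      fix \<eta> assume "\<eta> \<in> space \<mu>\<^sub>\<Gamma>"
      then have \<eta>: "\<eta> \<in> \<Gamma>" by (simp add: space_restrict_space)
      interpret tr: prob_space "config.trans t \<eta>" using \<eta> t by (intro config.prob_space_trans) simp_all
      show "norm (semigroup_op P t (indicator A) \<eta>) \<le> 1" by (simp add: op[OF \<eta>])
    qed
    ultimately show "integrable \<mu>\<^sub>\<Gamma> (semigroup_op P t (indicator A))"
      by (intro R.integrable_const_bound)
    show "AE \<eta> in \<mu>\<^sub>\<Gamma>. 0 \<le> semigroup_op P t (indicator A) \<eta>"
      by (intro AE_I2) (simp add: op space_restrict_space)
  qed
  also have "(\<integral>\<eta>. semigroup_op P t (indicator A) \<eta> \<partial>\<mu>\<^sub>\<Gamma>)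
      = (LINT \<eta>:\<Gamma>|\<mu>. semigroup_op P t (indicator A) \<eta>)"
    using state_space sets_\<mu> by (subst integral_restrict_space) (auto simp: set_lebesgue_integral_def)
  also have "\<dots> = (\<integral>\<eta>. indicator A \<eta> \<partial>\<mu>)"
  proof -
    have "bounded (range (indicator A :: _ \<Rightarrow> real))"
      by (rule boundedI[of _ 1]) (auto simp: indicator_def)
    then show ?thesis
      using invariant t A' unfolding invariant_measure_def by auto
  qed
  also have "\<dots> = measure \<mu> A" using A' sets_\<mu> by simp
  also have "\<dots> = measure \<mu>\<^sub>\<Gamma> A"
    using sub state_space sets_\<mu> by (subst measure_restrict_space) auto
  also have "ennreal \<dots> = emeasure \<mu>\<^sub>\<Gamma> A"
    by (intro finite_measure.emeasure_eq_measure[symmetric] prob_space.finite_measure prob_space_\<mu>\<^sub>\<Gamma>)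
  finally show "emeasure (\<mu>\<^sub>\<Gamma> \<bind> config.trans t) A = emeasure \<mu>\<^sub>\<Gamma> A" .
qed

lemma integrable_D: "\<xi> \<in> fin_configs \<Longrightarrow> integrable \<mu> (D \<xi>)"
  using tempered by (auto simp: tempered_def D_integrable_def)

lemma borel_measurable_D: "\<xi> \<in> fin_configs \<Longrightarrow> D \<xi> \<in> borel_measurable \<mu>"
  by (rule borel_measurable_integrable[OF integrable_D])

lemma nn_integral_D: "\<xi> \<in> fin_configs \<Longrightarrow> (\<integral>\<^sup>+\<eta>. ennreal (D \<xi> \<eta>) \<partial>\<mu>) = ennreal (D_transform D \<mu> \<xi>)"
  unfolding D_transform_def by (intro nn_integral_eq_integral integrable_D AE_I2 D_nonneg)

lemma D_transform_nonneg: "\<xi> \<in> fin_configs \<Longrightarrow> 0 \<le> D_transform D \<mu> \<xi>"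
  unfolding D_transform_def by (intro integral_nonneg_AE AE_I2 D_nonneg)

lemma D_transform_bounded:
  obtains b where "0 \<le> b" "\<And>\<xi>. num_particles \<xi> \<le> enat n \<Longrightarrow> D_transform D \<mu> \<xi> \<le> b"
proof -
  have "bdd_above (D_transform D \<mu> ` {\<xi>. num_particles \<xi> \<le> enat n})"
    using tempered by (auto simp: tempered_def)
  then obtain b where "\<And>\<xi>. num_particles \<xi> \<le> enat n \<Longrightarrow> D_transform D \<mu> \<xi> \<le> b"
    by (auto simp: bdd_above_def)
  then show ?thesis by (intro that[of "max b 0"]) (auto simp: le_max_iff_disj)
qed

lemma duality_trans:
  assumes "\<xi> \<in> fin_configs" and "\<eta> \<in> \<Gamma>" and "0 \<le> t"
  shows "(\<integral>\<^sup>+y. ennreal (D \<xi> y) \<partial>config.trans t \<eta>) = (\<integral>\<^sup>+\<zeta>. ennreal (D \<zeta> \<eta>) \<partial>dual_law t \<xi>)"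
proof -
  have "(\<lambda>y. ennreal (D \<xi> y)) \<in> borel_measurable (restrict_space config_space \<Gamma>)"
    using borel_measurable_E[OF borel_measurable_D[OF assms(1)]] by measurable
  then show ?thesis
    using assms by (simp add: config.nn_integral_trans nn_integral_dual_law duality)
qed

text \<open>Invariance allows \<open>D \<xi>\<close> to be replaced by its evolution under the configuration process without
changing the integral, and duality moves that evolution to \<open>\<xi>\<close>.\<close>

lemma D_transform_harmonic:
  assumes \<xi>: "\<xi> \<in> n_configs n" and t: "0 \<le> t"
  shows "(\<integral>\<^sup>+\<zeta>. ennreal (D_transform D \<mu> \<zeta>) \<partial>dual_law t \<xi>) = ennreal (D_transform D \<mu> \<xi>)"
proof -
  have fin: "\<xi> \<in> fin_configs" using \<xi> n_configs_subset_fin_configs by blast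
  have supp: "\<zeta> \<in> fin_configs" if "\<zeta> \<in> set_pmf (dual_law t \<xi>)" for \<zeta>
    using that set_dual_law[OF \<xi> t] n_configs_subset_fin_configs by blast
  have "ennreal (D_transform D \<mu> \<xi>) = (\<integral>\<^sup>+\<eta>. ennreal (D \<xi> \<eta>) \<partial>\<mu>\<^sub>\<Gamma>)"
    by (simp add: nn_integral_\<mu>\<^sub>\<Gamma> nn_integral_D fin)
  also have "\<dots> = (\<integral>\<^sup>+\<eta>. \<integral>\<^sup>+y. ennreal (D \<xi> y) \<partial>config.trans t \<eta> \<partial>\<mu>\<^sub>\<Gamma>)"
    using borel_measurable_E[OF borel_measurable_D[OF fin]]
    by (intro config.nn_integral_invariant[symmetric] sets_\<mu>\<^sub>\<Gamma> t bind_invariant) measurable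
  also have "\<dots> = (\<integral>\<^sup>+\<eta>. \<integral>\<^sup>+\<zeta>. ennreal (D \<zeta> \<eta>) \<partial>dual_law t \<xi> \<partial>\<mu>\<^sub>\<Gamma>)"
    by (intro nn_integral_cong duality_trans fin t) (simp add: space_restrict_space)
  also have "\<dots> = (\<integral>\<^sup>+\<zeta>. \<integral>\<^sup>+\<eta>. ennreal (D \<zeta> \<eta>) \<partial>\<mu> \<partial>dual_law t \<xi>)"
    unfolding nn_integral_\<mu>\<^sub>\<Gamma>
    by (rule nn_integral_pmf_swap) (use supp borel_measurable_D in measurable)
  also have "\<dots> = (\<integral>\<^sup>+\<zeta>. ennreal (D_transform D \<mu> \<zeta>) \<partial>dual_law t \<xi>)"
    using supp by (intro nn_integral_cong_AE) (simp add: AE_measure_pmf_iff nn_integral_D)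
  finally show ?thesis by simp
qed

text \<open>A bounded harmonic function takes the same value at two points whose trajectories can be coupled
successfully: the two coupled expectations differ by the expectation of a bounded quantity that
vanishes once the trajectories have met.\<close>

lemma D_transform_constant:
  assumes coupling: "admits_successful_coupling Pd"
    and \<xi>: "\<xi> \<in> n_configs n" and \<xi>': "\<xi>' \<in> n_configs n"
  shows "D_transform D \<mu> \<xi> = D_transform D \<mu> \<xi>'"
proof -
  \<comment> \<open>Temperedness bounds the transform only for bounded particle number; truncating it to
      \<open>n_configs n\<close> gives a globally bounded function.\<close>
  define F where "F \<zeta> = (if \<zeta> \<in> n_configs n then D_transform D \<mu> \<zeta> else 0)" for \<zeta>
  obtain b where b: "0 \<le> b" "\<And>\<zeta>. num_particles \<zeta> \<le> enat n \<Longrightarrow> D_transform D \<mu> \<zeta> \<le> b"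
    using D_transform_bounded by blast
  have F0: "0 \<le> F \<zeta>" and Fb: "F \<zeta> \<le> b" for \<zeta>
    using b D_transform_nonneg n_configs_subset_fin_configs[of n]
    by (auto simp: F_def n_configs_def)
  have harm: "(\<integral>\<omega>. F (\<omega> t) \<partial>Pd \<zeta>) = F \<zeta>" if \<zeta>: "\<zeta> \<in> n_configs n" and t: "0 \<le> t" for \<zeta> t
  proof -
    have fin: "\<zeta> \<in> fin_configs" using \<zeta> n_configs_subset_fin_configs by blast
    have "(\<integral>\<omega>. F (\<omega> t) \<partial>Pd \<zeta>) = (\<integral>\<zeta>'. F \<zeta>' \<partial>dual_law t \<zeta>)"
      by (rule integral_dual_law[OF fin t, symmetric])
    also have "\<dots> = enn2real (\<integral>\<^sup>+\<zeta>'. ennreal (F \<zeta>') \<partial>dual_law t \<zeta>)"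
      by (rule integral_eq_nn_integral) (simp_all add: F0)
    also have "(\<integral>\<^sup>+\<zeta>'. ennreal (F \<zeta>') \<partial>dual_law t \<zeta>)
        = (\<integral>\<^sup>+\<zeta>'. ennreal (D_transform D \<mu> \<zeta>') \<partial>dual_law t \<zeta>)"
      using set_dual_law[OF \<zeta> t]
      by (intro nn_integral_cong_AE) (auto simp: AE_measure_pmf_iff F_def)
    also have "\<dots> = ennreal (F \<zeta>)"
      using D_transform_harmonic[OF \<zeta> t] \<zeta> by (simp add: F_def)
    finally show ?thesis using F0 by simp
  qed
  obtain Q where Q: "is_coupling (Pd \<xi>) (Pd \<xi>') Q"
    and meet: "AE \<omega> in Q. coupling_time (fst \<omega>) (snd \<omega>) < \<infinity>"
    using coupling \<xi> \<xi>' unfolding admits_successful_coupling_def by blast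
  interpret Q: prob_space Q using Q by (simp add: is_coupling_def)
  have fin: "\<xi> \<in> fin_configs" "\<xi>' \<in> fin_configs"
    using \<xi> \<xi>' n_configs_subset_fin_configs by blast+
  have [measurable]: "fst \<in> Q \<rightarrow>\<^sub>M Pd \<xi>" "snd \<in> Q \<rightarrow>\<^sub>M Pd \<xi>'"
    using Q by (simp_all add: is_coupling_def cong: measurable_cong_sets)
  have Fm: "(\<lambda>\<omega>. F (\<omega> t)) \<in> borel_measurable (Pd \<zeta>)" if "\<zeta> \<in> fin_configs" "0 \<le> t" for \<zeta> t
    by (rule measurable_compose[OF measurable_dual_coordinate[OF that]]) simp
  have eq1: "(\<integral>w. F (fst w t) \<partial>Q) = F \<xi>" and eq2: "(\<integral>w. F (snd w t) \<partial>Q) = F \<xi>'"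
    if t: "0 \<le> t" for t
  proof -
    have "(\<integral>w. F (fst w t) \<partial>Q) = (\<integral>\<omega>. F (\<omega> t) \<partial>distr Q (Pd \<xi>) fst)"
      using Fm[OF fin(1) t] by (subst integral_distr) auto
    also have "\<dots> = F \<xi>" using Q harm[OF \<xi> t] by (simp add: is_coupling_def)
    finally show "(\<integral>w. F (fst w t) \<partial>Q) = F \<xi>" .
    have "(\<integral>w. F (snd w t) \<partial>Q) = (\<integral>\<omega>. F (\<omega> t) \<partial>distr Q (Pd \<xi>') snd)"
      using Fm[OF fin(2) t] by (subst integral_distr) auto
    also have "\<dots> = F \<xi>'" using Q harm[OF \<xi>' t] by (simp add: is_coupling_def)
    finally show "(\<integral>w. F (snd w t) \<partial>Q) = F \<xi>'" .
  qed
  have m1: "(\<lambda>w. F (fst w t)) \<in> borel_measurable Q" and m2: "(\<lambda>w. F (snd w t)) \<in> borel_measurable Q"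
    if t: "0 \<le> t" for t
    by (rule measurable_compose[OF _ Fm[OF fin(1) t]] measurable_compose[OF _ Fm[OF fin(2) t]], measurable)+
  have bnd: "\<bar>F \<zeta>\<bar> \<le> b" for \<zeta> using F0[of \<zeta>] Fb[of \<zeta>] by simp
  have "(\<lambda>k. \<integral>w. F (fst w (real k)) - F (snd w (real k)) \<partial>Q) \<longlonglongrightarrow> (\<integral>w. 0 \<partial>Q)"
  proof (rule integral_dominated_convergence[where w="\<lambda>_. 2 * b"])
    show "(\<lambda>w. F (fst w (real k)) - F (snd w (real k))) \<in> borel_measurable Q" for k
      using m1 m2 by simp
    show "AE w in Q. norm (F (fst w (real k)) - F (snd w (real k))) \<le> 2 * b" for k
    proof (rule AE_I2)
      fix w show "norm (F (fst w (real k)) - F (snd w (real k))) \<le> 2 * b"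
        using bnd[of "fst w (real k)"] bnd[of "snd w (real k)"] by simp
    qed
    show "AE w in Q. (\<lambda>k. F (fst w (real k)) - F (snd w (real k))) \<longlonglongrightarrow> 0"
      using meet
    proof eventually_elim
      case (elim w)
      then obtain T where T: "\<And>t. t \<ge> T \<Longrightarrow> fst w t = snd w t"
        unfolding coupling_time_def Inf_less_iff by auto
      have "\<forall>\<^sub>F k in sequentially. real k \<ge> T"
        using filterlim_real_sequentially by (auto simp: filterlim_at_top)
      then have "\<forall>\<^sub>F k in sequentially. 0 = F (fst w (real k)) - F (snd w (real k))"
        by eventually_elim (simp add: T)
      then show ?case by (rule Lim_transform_eventually[OF tendsto_const])
    qed
  qed auto
  moreover have "(\<integral>w. F (fst w (real k)) - F (snd w (real k)) \<partial>Q) = F \<xi> - F \<xi>'" for k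
  proof -
    have "integrable Q (\<lambda>w. F (fst w (real k)))" "integrable Q (\<lambda>w. F (snd w (real k)))"
      using m1 m2 bnd by (auto intro!: Q.integrable_const_bound[where B=b])
    then show ?thesis by (simp add: eq1 eq2)
  qed
  ultimately have "F \<xi> - F \<xi>' = 0" by (simp add: LIMSEQ_const_iff)
  then show ?thesis using \<xi> \<xi>' by (simp add: F_def)
qed

end

section \<open>Mixtures of duality functions\<close>

text \<open>Mixtures of the \<open>D \<xi>\<close> over a random \<open>\<xi>\<close> with a fixed number of particles form a convex set which
the semigroup maps into itself. The proof of factorization takes place in this set.\<close>

definition D_mixture :: "('g config \<Rightarrow> 'g config \<Rightarrow> real) \<Rightarrow> 'g config pmf \<Rightarrow> 'g config \<Rightarrow> real" where
  "D_mixture D \<pi> \<eta> = (\<integral>\<zeta>. D \<zeta> \<eta> \<partial>measure_pmf \<pi>)"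

context tempered_invariant_measure
begin

lemma D_L2_bounded:
  obtains B where "0 \<le> B"
    and "\<And>\<xi>. \<xi> \<in> n_configs n \<Longrightarrow> (\<integral>\<^sup>+\<eta>. ennreal ((D \<xi> \<eta>)\<^sup>2) \<partial>\<mu>) \<le> ennreal B"
proof -
  obtain a where a: "a \<ge> 0" and dom: "\<And>\<xi>. \<xi> \<in> n_configs n \<Longrightarrow>
      \<exists>R. finite R \<and> card R \<le> (2 * n + 1) ^ n \<and>
     R \<subseteq> {\<rho>. num_particles \<rho> \<le> enat (2 * n)} \<and>
     (\<forall>\<eta>. (D \<xi> \<eta>)\<^sup>2 \<le> a * (\<Sum>\<rho>\<in>R. D \<rho> \<eta>))"
    using D_square_le[of n] by blast
  obtain b where b: "0 \<le> b" "\<And>\<zeta>. num_particles \<zeta> \<le> enat (2 * n) \<Longrightarrow> D_transform D \<mu> \<zeta> \<le> b"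
    using D_transform_bounded by blast
  have "(\<integral>\<^sup>+\<eta>. ennreal ((D \<xi> \<eta>)\<^sup>2) \<partial>\<mu>) \<le> ennreal (a * (real ((2 * n + 1) ^ n) * b))"
    if \<xi>: "\<xi> \<in> n_configs n" for \<xi>
  proof -
    obtain R where R: "finite R" "card R \<le> (2 * n + 1) ^ n"
      "R \<subseteq> {\<rho>. num_particles \<rho> \<le> enat (2 * n)}"
      "\<And>\<eta>. (D \<xi> \<eta>)\<^sup>2 \<le> a * (\<Sum>\<rho>\<in>R. D \<rho> \<eta>)"
      using dom[OF \<xi>] by blast
    have Rfin: "\<rho> \<in> fin_configs" if "\<rho> \<in> R" for \<rho>
    proof -
      have "num_particles \<rho> \<le> enat (2 * n)" using that R(3) by blast
      also have "\<dots> < \<infinity>" by simp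
      finally show ?thesis by (simp add: fin_configs_def)
    qed
    have int: "integrable \<mu> (\<lambda>\<eta>. a * (\<Sum>\<rho>\<in>R. D \<rho> \<eta>))"
      by (intro integrable_mult_right Bochner_Integration.integrable_sum integrable_D Rfin)
    have "(\<integral>\<^sup>+\<eta>. ennreal ((D \<xi> \<eta>)\<^sup>2) \<partial>\<mu>) \<le> (\<integral>\<^sup>+\<eta>. ennreal (a * (\<Sum>\<rho>\<in>R. D \<rho> \<eta>)) \<partial>\<mu>)"
      by (intro nn_integral_mono ennreal_leI R(4))
    also have "\<dots> = ennreal (\<integral>\<eta>. a * (\<Sum>\<rho>\<in>R. D \<rho> \<eta>) \<partial>\<mu>)"
      using a Rfin by (intro nn_integral_eq_integral int AE_I2 mult_nonneg_nonneg sum_nonneg D_nonneg)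
    also have "(\<integral>\<eta>. a * (\<Sum>\<rho>\<in>R. D \<rho> \<eta>) \<partial>\<mu>) = a * (\<Sum>\<rho>\<in>R. D_transform D \<mu> \<rho>)"
      unfolding D_transform_def
      by (simp add: Bochner_Integration.integral_sum integrable_D Rfin)
    also have "\<dots> \<le> a * (\<Sum>\<rho>\<in>R. b)"
      using R(3) b(2) a by (intro mult_left_mono sum_mono) auto
    also have "\<dots> \<le> a * (real ((2 * n + 1) ^ n) * b)"
      using R(2) a b(1) unfolding sum_constant of_nat_le_iff[symmetric, where 'a=real]
      by (intro mult_left_mono mult_right_mono)
    finally show ?thesis by (simp add: ennreal_leI)
  qed
  then show ?thesis using a b(1) by (intro that[of "a * (real ((2 * n + 1) ^ n) * b)"]) auto
qed

lemma set_bind_dual_law: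
  assumes "set_pmf \<pi> \<subseteq> n_configs n" and "0 \<le> t"
  shows "set_pmf (bind_pmf \<pi> (dual_law t)) \<subseteq> n_configs n"
  using assms set_dual_law by fastforce

lemma D_mixture_eq_enn2real:
  assumes "set_pmf \<pi> \<subseteq> n_configs n"
  shows "D_mixture D \<pi> \<eta> = enn2real (\<integral>\<^sup>+\<zeta>. ennreal (D \<zeta> \<eta>) \<partial>\<pi>)"
  unfolding D_mixture_def
  using assms n_configs_subset_fin_configs
  by (intro integral_eq_nn_integral) (auto simp: AE_measure_pmf_iff intro!: D_nonneg)

lemma D_mixture_nonneg: "set_pmf \<pi> \<subseteq> n_configs n \<Longrightarrow> 0 \<le> D_mixture D \<pi> \<eta>"
  by (simp add: D_mixture_eq_enn2real)

lemma borel_measurable_nn_D_mixture: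
  assumes "set_pmf \<pi> \<subseteq> n_configs n"
  shows "(\<lambda>\<eta>. \<integral>\<^sup>+\<zeta>. ennreal (D \<zeta> \<eta>) \<partial>\<pi>) \<in> borel_measurable \<mu>"
  using assms n_configs_subset_fin_configs
  by (intro measurable_nn_integral_pmf measurable_compose[OF borel_measurable_D measurable_ennreal]) blast

lemma borel_measurable_D_mixture:
  assumes "set_pmf \<pi> \<subseteq> n_configs n"
  shows "D_mixture D \<pi> \<in> borel_measurable \<mu>"
proof -
  have "(\<lambda>\<eta>. enn2real (\<integral>\<^sup>+\<zeta>. ennreal (D \<zeta> \<eta>) \<partial>\<pi>)) \<in> borel_measurable \<mu>"
    using borel_measurable_nn_D_mixture[OF assms] by measurable
  then show ?thesis by (simp add: D_mixture_eq_enn2real[OF assms] cong: measurable_cong)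
qed

lemma nn_integral_D_mixture_mult:
  assumes \<pi>: "set_pmf \<pi> \<subseteq> n_configs n" and g: "g \<in> borel_measurable \<mu>"
  shows "(\<integral>\<^sup>+\<eta>. g \<eta> * (\<integral>\<^sup>+\<zeta>. ennreal (D \<zeta> \<eta>) \<partial>\<pi>) \<partial>\<mu>)
    = (\<integral>\<^sup>+\<zeta>. \<integral>\<^sup>+\<eta>. g \<eta> * ennreal (D \<zeta> \<eta>) \<partial>\<mu> \<partial>\<pi>)"
proof -
  have "(\<lambda>\<eta>. g \<eta> * ennreal (D \<zeta> \<eta>)) \<in> borel_measurable \<mu>" if "\<zeta> \<in> set_pmf \<pi>" for \<zeta>
    using g measurable_compose[OF borel_measurable_D measurable_ennreal] that \<pi> n_configs_subset_fin_configs
    by (intro borel_measurable_times_ennreal) blast+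
  then show ?thesis
    by (subst nn_integral_pmf_swap[symmetric]) (auto simp: nn_integral_cmult intro!: nn_integral_cong)
qed

text \<open>The expectation in \<open>D_mixture\<close> has the default value 0 where it diverges; this happens only on a null
set, since the transform is bounded on \<open>n_configs n\<close>.\<close>

lemma AE_nn_D_mixture:
  assumes \<pi>: "set_pmf \<pi> \<subseteq> n_configs n"
  shows "AE \<eta> in \<mu>. (\<integral>\<^sup>+\<zeta>. ennreal (D \<zeta> \<eta>) \<partial>\<pi>) = ennreal (D_mixture D \<pi> \<eta>)"
proof -
  obtain b where b: "0 \<le> b" "\<And>\<zeta>. num_particles \<zeta> \<le> enat n \<Longrightarrow> D_transform D \<mu> \<zeta> \<le> b"
    using D_transform_bounded by blast
  have "(\<integral>\<^sup>+\<eta>. \<integral>\<^sup>+\<zeta>. ennreal (D \<zeta> \<eta>) \<partial>\<pi> \<partial>\<mu>) = (\<integral>\<^sup>+\<zeta>. \<integral>\<^sup>+\<eta>. ennreal (D \<zeta> \<eta>) \<partial>\<mu> \<partial>\<pi>)"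
    using nn_integral_D_mixture_mult[OF \<pi>, of "\<lambda>_. 1"] by simp
  also have "\<dots> \<le> (\<integral>\<^sup>+\<zeta>. ennreal b \<partial>\<pi>)"
  proof (rule nn_integral_mono_AE, unfold AE_measure_pmf_iff, rule ballI)
    fix \<zeta> assume "\<zeta> \<in> set_pmf \<pi>"
    then have \<zeta>: "\<zeta> \<in> n_configs n" using \<pi> by blast
    then have "\<zeta> \<in> fin_configs" using n_configs_subset_fin_configs by blast
    then show "(\<integral>\<^sup>+\<eta>. ennreal (D \<zeta> \<eta>) \<partial>\<mu>) \<le> ennreal b"
      using b(2)[of \<zeta>] \<zeta> by (simp add: nn_integral_D n_configs_def ennreal_leI)
  qed
  also have "\<dots> < \<infinity>" by (simp add: measure_pmf.emeasure_space_1)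
  finally have "AE \<eta> in \<mu>. (\<integral>\<^sup>+\<zeta>. ennreal (D \<zeta> \<eta>) \<partial>\<pi>) \<noteq> \<infinity>"
    by (intro nn_integral_PInf_AE borel_measurable_nn_D_mixture[OF \<pi>]) simp
  then show ?thesis
    by eventually_elim (simp add: D_mixture_eq_enn2real[OF \<pi>] top.not_eq_extremum)
qed

lemma nn_integral_D_mixture_square_le:
  assumes \<pi>: "set_pmf \<pi> \<subseteq> n_configs n"
    and B: "\<And>\<xi>. \<xi> \<in> n_configs n \<Longrightarrow> (\<integral>\<^sup>+\<eta>. ennreal ((D \<xi> \<eta>)\<^sup>2) \<partial>\<mu>) \<le> ennreal B"
  shows "(\<integral>\<^sup>+\<eta>. ennreal ((D_mixture D \<pi> \<eta>)\<^sup>2) \<partial>\<mu>) \<le> ennreal B"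
proof -
  have "(\<integral>\<^sup>+\<eta>. ennreal ((D_mixture D \<pi> \<eta>)\<^sup>2) \<partial>\<mu>)
      \<le> (\<integral>\<^sup>+\<eta>. \<integral>\<^sup>+\<zeta>. ennreal ((D \<zeta> \<eta>)\<^sup>2) \<partial>\<pi> \<partial>\<mu>)"
    unfolding D_mixture_def
    by (intro nn_integral_mono measure_pmf.square_expectation_le_nn_integral_square) simp
  also have "\<dots> = (\<integral>\<^sup>+\<zeta>. \<integral>\<^sup>+\<eta>. ennreal ((D \<zeta> \<eta>)\<^sup>2) \<partial>\<mu> \<partial>\<pi>)"
  proof (rule nn_integral_pmf_swap)
    fix \<zeta> assume "\<zeta> \<in> set_pmf \<pi>"
    then have [measurable]: "D \<zeta> \<in> borel_measurable \<mu>"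
      using borel_measurable_D \<pi> n_configs_subset_fin_configs by blast
    show "(\<lambda>\<eta>. ennreal ((D \<zeta> \<eta>)\<^sup>2)) \<in> borel_measurable \<mu>" by measurable
  qed
  also have "\<dots> \<le> (\<integral>\<^sup>+\<zeta>. ennreal B \<partial>\<pi>)"
    using B \<pi> by (intro nn_integral_mono_AE) (auto simp: AE_measure_pmf_iff)
  finally show ?thesis by (simp add: measure_pmf.emeasure_space_1)
qed

lemma D_mixture_L2:
  assumes \<pi>: "set_pmf \<pi> \<subseteq> n_configs n"
  shows "integrable \<mu> (\<lambda>\<eta>. (D_mixture D \<pi> \<eta>)\<^sup>2)"
proof (rule integrableI_bounded)
  show "(\<lambda>\<eta>. (D_mixture D \<pi> \<eta>)\<^sup>2) \<in> borel_measurable \<mu>"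
    using borel_measurable_D_mixture[OF \<pi>] by measurable
  obtain B where "\<And>\<xi>. \<xi> \<in> n_configs n \<Longrightarrow> (\<integral>\<^sup>+\<eta>. ennreal ((D \<xi> \<eta>)\<^sup>2) \<partial>\<mu>) \<le> ennreal B"
    using D_L2_bounded by blast
  from nn_integral_D_mixture_square_le[OF \<pi> this]
  show "(\<integral>\<^sup>+\<eta>. ennreal (norm ((D_mixture D \<pi> \<eta>)\<^sup>2)) \<partial>\<mu>) < \<infinity>"
    by (simp add: le_less_trans)
qed

lemma D_mixture_return: "D_mixture D (return_pmf \<xi>) = D \<xi>"
  by (simp add: D_mixture_def fun_eq_iff)

lemma integrable_D_mixture_mult:
  assumes "set_pmf \<pi> \<subseteq> n_configs n" and "set_pmf \<pi>' \<subseteq> n_configs m"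
  shows "integrable \<mu> (\<lambda>\<eta>. D_mixture D \<pi> \<eta> * D_mixture D \<pi>' \<eta>)"
proof (rule Bochner_Integration.integrable_bound)
  show "integrable \<mu> (\<lambda>\<eta>. (D_mixture D \<pi> \<eta>)\<^sup>2 + (D_mixture D \<pi>' \<eta>)\<^sup>2)"
    using assms by (intro Bochner_Integration.integrable_add D_mixture_L2)
  show "(\<lambda>\<eta>. D_mixture D \<pi> \<eta> * D_mixture D \<pi>' \<eta>) \<in> borel_measurable \<mu>"
    using assms by (intro borel_measurable_times borel_measurable_D_mixture)
  show "AE \<eta> in \<mu>. norm (D_mixture D \<pi> \<eta> * D_mixture D \<pi>' \<eta>)
      \<le> norm ((D_mixture D \<pi> \<eta>)\<^sup>2 + (D_mixture D \<pi>' \<eta>)\<^sup>2)"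
  proof (rule AE_I2)
    fix \<eta>
    have "0 \<le> (\<bar>D_mixture D \<pi> \<eta>\<bar> - \<bar>D_mixture D \<pi>' \<eta>\<bar>)\<^sup>2" by simp
    then have "2 * (\<bar>D_mixture D \<pi> \<eta>\<bar> * \<bar>D_mixture D \<pi>' \<eta>\<bar>)
        \<le> (D_mixture D \<pi> \<eta>)\<^sup>2 + (D_mixture D \<pi>' \<eta>)\<^sup>2"
      by (simp add: power2_diff)
    moreover have "0 \<le> \<bar>D_mixture D \<pi> \<eta>\<bar> * \<bar>D_mixture D \<pi>' \<eta>\<bar>" by simp
    ultimately have "\<bar>D_mixture D \<pi> \<eta>\<bar> * \<bar>D_mixture D \<pi>' \<eta>\<bar>
        \<le> (D_mixture D \<pi> \<eta>)\<^sup>2 + (D_mixture D \<pi>' \<eta>)\<^sup>2"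
      by linarith
    then show "norm (D_mixture D \<pi> \<eta> * D_mixture D \<pi>' \<eta>)
      \<le> norm ((D_mixture D \<pi> \<eta>)\<^sup>2 + (D_mixture D \<pi>' \<eta>)\<^sup>2)"
      by (simp add: abs_mult)
  qed
qed

lemma integrable_D_mult:
  assumes "\<xi> \<in> n_configs n" and "\<zeta> \<in> n_configs m"
  shows "integrable \<mu> (\<lambda>\<eta>. D \<xi> \<eta> * D \<zeta> \<eta>)"
  using integrable_D_mixture_mult[of "return_pmf \<xi>" n "return_pmf \<zeta>" m] assms
  by (simp add: D_mixture_return)

lemma integrable_D_mixture:
  assumes "set_pmf \<pi> \<subseteq> n_configs n"
  shows "integrable \<mu> (D_mixture D \<pi>)"
  by (rule \<mu>.square_integrable_imp_integrable[OF borel_measurable_D_mixture D_mixture_L2]) (rule assms)+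

lemma D_mult_bounded:
  obtains C where "0 \<le> C"
    and "\<And>\<xi> \<zeta>. \<lbrakk>\<xi> \<in> n_configs n; \<zeta> \<in> n_configs m\<rbrakk> \<Longrightarrow> (\<integral>\<eta>. D \<xi> \<eta> * D \<zeta> \<eta> \<partial>\<mu>) \<le> C"
proof -
  obtain B where B: "0 \<le> B" "\<And>\<xi>. \<xi> \<in> n_configs n \<Longrightarrow> (\<integral>\<^sup>+\<eta>. ennreal ((D \<xi> \<eta>)\<^sup>2) \<partial>\<mu>) \<le> ennreal B"
    using D_L2_bounded by blast
  obtain B' where B': "0 \<le> B'" "\<And>\<xi>. \<xi> \<in> n_configs m \<Longrightarrow> (\<integral>\<^sup>+\<eta>. ennreal ((D \<xi> \<eta>)\<^sup>2) \<partial>\<mu>) \<le> ennreal B'"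
    using D_L2_bounded by blast
  have "(\<integral>\<eta>. D \<xi> \<eta> * D \<zeta> \<eta> \<partial>\<mu>) \<le> B + B'" if \<xi>: "\<xi> \<in> n_configs n" and \<zeta>: "\<zeta> \<in> n_configs m" for \<xi> \<zeta>
  proof -
    have i: "integrable \<mu> (\<lambda>\<eta>. (D \<xi> \<eta>)\<^sup>2)" "integrable \<mu> (\<lambda>\<eta>. (D \<zeta> \<eta>)\<^sup>2)"
      using D_mixture_L2[of "return_pmf \<xi>"] D_mixture_L2[of "return_pmf \<zeta>"] \<xi> \<zeta>
      by (auto simp: D_mixture_return)
    have "(\<integral>\<eta>. D \<xi> \<eta> * D \<zeta> \<eta> \<partial>\<mu>) \<le> (\<integral>\<eta>. (D \<xi> \<eta>)\<^sup>2 + (D \<zeta> \<eta>)\<^sup>2 \<partial>\<mu>)"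
    proof (intro integral_mono integrable_D_mult[OF \<xi> \<zeta>] Bochner_Integration.integrable_add i)
      fix \<eta>
      have "0 \<le> (D \<xi> \<eta> - D \<zeta> \<eta>)\<^sup>2" by simp
      moreover have "0 \<le> (D \<xi> \<eta>)\<^sup>2 + (D \<zeta> \<eta>)\<^sup>2" by simp
      ultimately show "D \<xi> \<eta> * D \<zeta> \<eta> \<le> (D \<xi> \<eta>)\<^sup>2 + (D \<zeta> \<eta>)\<^sup>2"
        unfolding power2_diff by linarith
    qed
    also have "\<dots> = (\<integral>\<eta>. (D \<xi> \<eta>)\<^sup>2 \<partial>\<mu>) + (\<integral>\<eta>. (D \<zeta> \<eta>)\<^sup>2 \<partial>\<mu>)"
      using i by simp
    also have "\<dots> \<le> B + B'"
      using B(2)[OF \<xi>] B'(2)[OF \<zeta>] i B(1) B'(1) by (intro add_mono) (simp_all add: nn_integral_eq_integral)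
    finally show ?thesis .
  qed
  then show ?thesis using B(1) B'(1) by (intro that[of "B + B'"]) auto
qed

text \<open>By duality, evolving a mixture under the configuration process amounts to letting its random
configuration move according to the dual process.\<close>

lemma semigroup_op_D_mixture:
  assumes \<pi>: "set_pmf \<pi> \<subseteq> n_configs n" and t: "0 \<le> t"
  shows "AE \<eta> in \<mu>. semigroup_op P t (D_mixture D \<pi>) \<eta> = D_mixture D (bind_pmf \<pi> (dual_law t)) \<eta>"
proof -
  let ?\<pi>' = "bind_pmf \<pi> (dual_law t)"
  let ?H = "\<lambda>\<pi> \<eta>. \<integral>\<^sup>+\<zeta>. ennreal (D \<zeta> \<eta>) \<partial>measure_pmf \<pi>"
  note \<pi>' = set_bind_dual_law[OF \<pi> t]
  show ?thesis
    using AE_nn_D_mixture[OF \<pi>'] AE_\<Gamma>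
  proof eventually_elim
    case (elim \<eta>)
    have mix: "D_mixture D \<pi> \<in> borel_measurable (config.trans t \<eta>)"
      "?H \<pi> \<in> borel_measurable (config.trans t \<eta>)"
      using borel_measurable_E[OF borel_measurable_D_mixture[OF \<pi>]]
        measurable_restrict_space1[OF borel_measurable_nn_D_mixture[OF \<pi>, unfolded borel_measurable_\<mu>]]
      by (simp_all cong: measurable_cong_sets)
    have "(\<integral>\<^sup>+y. ?H \<pi> y \<partial>config.trans t \<eta>)
        = (\<integral>\<^sup>+\<zeta>. \<integral>\<^sup>+y. ennreal (D \<zeta> y) \<partial>config.trans t \<eta> \<partial>\<pi>)"
    proof (rule nn_integral_pmf_swap)
      fix \<zeta> assume "\<zeta> \<in> set_pmf \<pi>"
      then have "D \<zeta> \<in> borel_measurable (restrict_space config_space \<Gamma>)"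
        using borel_measurable_E[OF borel_measurable_D] \<pi> n_configs_subset_fin_configs by blast
      then show "(\<lambda>y. ennreal (D \<zeta> y)) \<in> borel_measurable (config.trans t \<eta>)"
        by (simp cong: measurable_cong_sets)
    qed
    also have "\<dots> = (\<integral>\<^sup>+\<zeta>. \<integral>\<^sup>+\<zeta>'. ennreal (D \<zeta>' \<eta>) \<partial>dual_law t \<zeta> \<partial>\<pi>)"
      using \<pi> n_configs_subset_fin_configs elim(2) t
      by (intro nn_integral_cong_AE) (auto simp: AE_measure_pmf_iff intro!: duality_trans)
    also have "\<dots> = ?H ?\<pi>' \<eta>" by simp
    finally have H: "(\<integral>\<^sup>+y. ?H \<pi> y \<partial>config.trans t \<eta>) = ?H ?\<pi>' \<eta>" .
    also have "?H ?\<pi>' \<eta> \<noteq> \<infinity>" using elim(1) by simp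
    finally have fin: "AE y in config.trans t \<eta>. ?H \<pi> y \<noteq> \<infinity>"
      by (intro nn_integral_PInf_AE mix)
    have "semigroup_op P t (D_mixture D \<pi>) \<eta> = (\<integral>y. D_mixture D \<pi> y \<partial>config.trans t \<eta>)"
      using elim(2) t borel_measurable_E[OF borel_measurable_D_mixture[OF \<pi>]]
      by (intro config.semigroup_op_eq_trans) simp_all
    also have "\<dots> = enn2real (\<integral>\<^sup>+y. ennreal (D_mixture D \<pi> y) \<partial>config.trans t \<eta>)"
      using D_mixture_nonneg[OF \<pi>] by (intro integral_eq_nn_integral mix) simp
    also have "(\<integral>\<^sup>+y. ennreal (D_mixture D \<pi> y) \<partial>config.trans t \<eta>) = (\<integral>\<^sup>+y. ?H \<pi> y \<partial>config.trans t \<eta>)"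
      using fin by (intro nn_integral_cong_AE, eventually_elim)
        (simp add: D_mixture_eq_enn2real[OF \<pi>] top.not_eq_extremum)
    also have "enn2real \<dots> = D_mixture D ?\<pi>' \<eta>"
      unfolding H by (simp add: D_mixture_eq_enn2real[OF \<pi>'])
    finally show ?case .
  qed
qed

text \<open>A fair coin that selects one of the two distributions realizes the midpoint.\<close>

lemma D_mixture_midpoint:
  assumes \<pi>: "set_pmf \<pi> \<subseteq> n_configs n" and \<pi>': "set_pmf \<pi>' \<subseteq> n_configs n"
  obtains \<rho> where "set_pmf \<rho> \<subseteq> n_configs n"
    and "AE \<eta> in \<mu>. D_mixture D \<rho> \<eta> = (D_mixture D \<pi> \<eta> + D_mixture D \<pi>' \<eta>) / 2"
proof -
  let ?H = "\<lambda>\<pi> \<eta>. \<integral>\<^sup>+\<zeta>. ennreal (D \<zeta> \<eta>) \<partial>measure_pmf \<pi>"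
  define \<rho> where "\<rho> = bind_pmf (bernoulli_pmf (1/2)) (\<lambda>b. if b then \<pi> else \<pi>')"
  have \<rho>: "set_pmf \<rho> \<subseteq> n_configs n" using \<pi> \<pi>' by (auto simp: \<rho>_def split: if_splits)
  have H: "?H \<rho> \<eta> = ?H \<pi> \<eta> * ennreal (1/2) + ?H \<pi>' \<eta> * ennreal (1/2)" for \<eta>
    unfolding \<rho>_def by (subst nn_integral_bind_pmf, subst nn_integral_bernoulli_pmf) auto
  have "AE \<eta> in \<mu>. D_mixture D \<rho> \<eta> = (D_mixture D \<pi> \<eta> + D_mixture D \<pi>' \<eta>) / 2"
    using AE_nn_D_mixture[OF \<pi>] AE_nn_D_mixture[OF \<pi>']
  proof eventually_elim
    case (elim \<eta>)
    then have "?H \<rho> \<eta> = ennreal ((D_mixture D \<pi> \<eta> + D_mixture D \<pi>' \<eta>) / 2)"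
      using D_mixture_nonneg[OF \<pi>, of \<eta>] D_mixture_nonneg[OF \<pi>', of \<eta>]
      unfolding H elim
      by (subst ennreal_mult[symmetric], simp, simp)+ (simp add: add_divide_distrib)
    then show ?case
      using D_mixture_nonneg[OF \<pi>, of \<eta>] D_mixture_nonneg[OF \<pi>', of \<eta>]
      by (simp add: D_mixture_eq_enn2real[OF \<rho>])
  qed
  with \<rho> show ?thesis by (rule that)
qed

lemma integral_D_mult_mixture:
  assumes \<xi>: "\<xi> \<in> n_configs m" and \<pi>: "set_pmf \<pi> \<subseteq> n_configs n"
  shows "(\<integral>\<eta>. D \<xi> \<eta> * D_mixture D \<pi> \<eta> \<partial>\<mu>) = (\<integral>\<zeta>. (\<integral>\<eta>. D \<xi> \<eta> * D \<zeta> \<eta> \<partial>\<mu>) \<partial>\<pi>)"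
proof -
  have fin: "\<xi> \<in> fin_configs" and pfin: "\<And>\<zeta>. \<zeta> \<in> set_pmf \<pi> \<Longrightarrow> \<zeta> \<in> fin_configs"
    using \<xi> \<pi> n_configs_subset_fin_configs by blast+
  have "(\<integral>\<eta>. D \<xi> \<eta> * D_mixture D \<pi> \<eta> \<partial>\<mu>)
      = enn2real (\<integral>\<^sup>+\<eta>. ennreal (D \<xi> \<eta> * D_mixture D \<pi> \<eta>) \<partial>\<mu>)"
    using D_nonneg[OF fin] D_mixture_nonneg[OF \<pi>]
    by (intro integral_eq_nn_integral borel_measurable_times borel_measurable_D[OF fin]
        borel_measurable_D_mixture[OF \<pi>]) simp
  also have "(\<integral>\<^sup>+\<eta>. ennreal (D \<xi> \<eta> * D_mixture D \<pi> \<eta>) \<partial>\<mu>)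
      = (\<integral>\<^sup>+\<eta>. ennreal (D \<xi> \<eta>) * (\<integral>\<^sup>+\<zeta>. ennreal (D \<zeta> \<eta>) \<partial>\<pi>) \<partial>\<mu>)"
    using AE_nn_D_mixture[OF \<pi>]
    by (intro nn_integral_cong_AE, eventually_elim) (simp add: ennreal_mult' D_nonneg[OF fin])
  also have "\<dots> = (\<integral>\<^sup>+\<zeta>. \<integral>\<^sup>+\<eta>. ennreal (D \<xi> \<eta>) * ennreal (D \<zeta> \<eta>) \<partial>\<mu> \<partial>\<pi>)"
    by (intro nn_integral_D_mixture_mult[OF \<pi>] measurable_compose[OF borel_measurable_D[OF fin] measurable_ennreal])
  also have "\<dots> = (\<integral>\<^sup>+\<zeta>. ennreal (\<integral>\<eta>. D \<xi> \<eta> * D \<zeta> \<eta> \<partial>\<mu>) \<partial>\<pi>)"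
  proof (rule nn_integral_cong_AE, unfold AE_measure_pmf_iff, rule ballI)
    fix \<zeta> assume \<zeta>: "\<zeta> \<in> set_pmf \<pi>"
    have "(\<integral>\<^sup>+\<eta>. ennreal (D \<xi> \<eta>) * ennreal (D \<zeta> \<eta>) \<partial>\<mu>) = (\<integral>\<^sup>+\<eta>. ennreal (D \<xi> \<eta> * D \<zeta> \<eta>) \<partial>\<mu>)"
      by (simp add: ennreal_mult' D_nonneg[OF fin])
    also have "\<dots> = ennreal (\<integral>\<eta>. D \<xi> \<eta> * D \<zeta> \<eta> \<partial>\<mu>)"
      using \<zeta> \<pi> \<xi> fin pfin
      by (intro nn_integral_eq_integral integrable_D_mult[of _ m _ n]) (auto intro!: AE_I2 mult_nonneg_nonneg D_nonneg)
    finally show "(\<integral>\<^sup>+\<eta>. ennreal (D \<xi> \<eta>) * ennreal (D \<zeta> \<eta>) \<partial>\<mu>) = ennreal (\<integral>\<eta>. D \<xi> \<eta> * D \<zeta> \<eta> \<partial>\<mu>)" .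
  qed
  also have "enn2real \<dots> = (\<integral>\<zeta>. (\<integral>\<eta>. D \<xi> \<eta> * D \<zeta> \<eta> \<partial>\<mu>) \<partial>\<pi>)"
    using fin pfin
    by (intro integral_eq_nn_integral[symmetric])
       (auto simp: AE_measure_pmf_iff intro!: integral_nonneg_AE AE_I2 mult_nonneg_nonneg D_nonneg)
  finally show ?thesis .
qed

end

section \<open>Ergodicity makes the transform multiplicative\<close>

locale constant_transform = tempered_invariant_measure \<Gamma> W P Wd Pd D d \<mu>
  for \<Gamma> :: "('g::countable) config set" and W P Wd Pd D d \<mu> +
  fixes f :: "nat \<Rightarrow> real"
  assumes transform_const: "\<xi> \<in> n_configs n \<Longrightarrow> D_transform D \<mu> \<xi> = f n"
begin

lemma integral_D: "\<xi> \<in> n_configs n \<Longrightarrow> (\<integral>\<eta>. D \<xi> \<eta> \<partial>\<mu>) = f n"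
  using transform_const by (simp add: D_transform_def)

lemma integral_D_mixture:
  assumes \<pi>: "set_pmf \<pi> \<subseteq> n_configs n"
  shows "(\<integral>\<eta>. D_mixture D \<pi> \<eta> \<partial>\<mu>) = f n"
proof -
  \<comment> \<open>The constant 1 is the duality function of the empty configuration, so the integral is a pairing.\<close>
  have z: "(\<lambda>_. 0) \<in> n_configs 0" using single_site_in_n_configs[of undefined 0] by simp
  have "(\<integral>\<eta>. D_mixture D \<pi> \<eta> \<partial>\<mu>) = (\<integral>\<zeta>. (\<integral>\<eta>. D \<zeta> \<eta> \<partial>\<mu>) \<partial>\<pi>)"
    using integral_D_mult_mixture[OF z \<pi>] by (simp add: D_empty)
  also have "\<dots> = (\<integral>\<zeta>. f n \<partial>\<pi>)"
    using \<pi> integral_D by (intro integral_cong_AE) (auto simp: AE_measure_pmf_iff)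
  finally show ?thesis by simp
qed

lemma integral_D_mixture_centered_square:
  assumes \<pi>: "set_pmf \<pi> \<subseteq> n_configs n"
  shows "(\<integral>\<eta>. (D_mixture D \<pi> \<eta> - f n)\<^sup>2 \<partial>\<mu>) = (\<integral>\<eta>. (D_mixture D \<pi> \<eta>)\<^sup>2 \<partial>\<mu>) - (f n)\<^sup>2"
  using \<mu>.variance_eq[OF integrable_D_mixture[OF \<pi>] D_mixture_L2[OF \<pi>]] integral_D_mixture[OF \<pi>] by simp

lemma integrable_centered_square:
  assumes \<pi>: "set_pmf \<pi> \<subseteq> n_configs n"
  shows "integrable \<mu> (\<lambda>\<eta>. (D_mixture D \<pi> \<eta> - c)\<^sup>2)"
proof -
  have "integrable \<mu> (\<lambda>\<eta>. (D_mixture D \<pi> \<eta>)\<^sup>2 + c\<^sup>2 - 2 * D_mixture D \<pi> \<eta> * c)"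
    using D_mixture_L2[OF \<pi>] integrable_D_mixture[OF \<pi>] by simp
  then show ?thesis by (simp add: power2_diff)
qed

text \<open>As time passes, the dual particles leave the support of \<open>\<xi>\<close>. For disjoint supports the product
\<open>D \<xi> \<cdot> D \<zeta>\<close> is the duality function of the configuration \<open>\<xi> + \<zeta>\<close> with \<open>m + n\<close> particles, whose
integral is \<open>f (m + n)\<close>. The remaining event has vanishing probability, and on it the integrals are
uniformly bounded.\<close>

lemma D_mixture_evolution_decorrelates:
  assumes \<xi>: "\<xi> \<in> n_configs m" and \<pi>: "set_pmf \<pi> \<subseteq> n_configs n"
  shows "(\<lambda>k. \<integral>\<eta>. D \<xi> \<eta> * D_mixture D (bind_pmf \<pi> (dual_law (real k))) \<eta> \<partial>\<mu>) \<longlonglongrightarrow> f (m + n)"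
proof -
  define K where "K \<zeta> = (\<integral>\<eta>. D \<xi> \<eta> * D \<zeta> \<eta> \<partial>\<mu>)" for \<zeta>
  define A where "A = {\<zeta>. \<not> disjoint_supp \<zeta> \<xi>}"
  define \<rho> where "\<rho> k = bind_pmf \<pi> (dual_law (real k))" for k
  have \<rho>: "set_pmf (\<rho> k) \<subseteq> n_configs n" for k
    unfolding \<rho>_def by (rule set_bind_dual_law[OF \<pi>]) simp
  have fin: "\<xi> \<in> fin_configs" and nfin: "\<And>\<zeta>. \<zeta> \<in> n_configs n \<Longrightarrow> \<zeta> \<in> fin_configs"
    using \<xi> n_configs_subset_fin_configs by blast+
  obtain C where C: "0 \<le> C" "\<And>\<zeta>. \<zeta> \<in> n_configs n \<Longrightarrow> K \<zeta> \<le> C"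
    unfolding K_def using D_mult_bounded[of m n] \<xi> by metis
  have K0: "0 \<le> K \<zeta>" if "\<zeta> \<in> n_configs n" for \<zeta>
    unfolding K_def using fin nfin[OF that] by (intro integral_nonneg_AE AE_I2 mult_nonneg_nonneg D_nonneg)
  have Kdisj: "K \<zeta> = f (m + n)" if \<zeta>: "\<zeta> \<in> n_configs n" and disj: "\<zeta> \<notin> A" for \<zeta>
  proof -
    have "disjoint_supp \<xi> \<zeta>" using disj by (auto simp: A_def disjoint_supp_def)
    then show ?thesis
      unfolding K_def D_mult_disjoint[OF fin nfin[OF \<zeta>] \<open>disjoint_supp \<xi> \<zeta>\<close>]
      by (intro integral_D add_in_n_configs \<xi> \<zeta>)
  qed
  let ?c = "C + \<bar>f (m + n)\<bar>"
  have Kbd: "\<bar>K \<zeta> - f (m + n)\<bar> \<le> ?c * indicator A \<zeta>" if "\<zeta> \<in> n_configs n" for \<zeta>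
    using Kdisj[OF that] K0[OF that] C(2)[OF that] by (cases "\<zeta> \<in> A") auto
  have Kint: "integrable (\<rho> k) K" for k
  proof (rule measure_pmf.integrable_const_bound)
    show "AE \<zeta> in \<rho> k. norm (K \<zeta>) \<le> C"
      using \<rho>[of k] K0 C(2) by (auto simp: AE_measure_pmf_iff)
  qed simp
  have close: "\<bar>(\<integral>\<zeta>. K \<zeta> \<partial>\<rho> k) - f (m + n)\<bar> \<le> ?c * measure_pmf.prob (\<rho> k) A" for k
  proof -
    have "\<bar>(\<integral>\<zeta>. K \<zeta> \<partial>\<rho> k) - f (m + n)\<bar> = \<bar>\<integral>\<zeta>. K \<zeta> - f (m + n) \<partial>\<rho> k\<bar>"
      using Kint by simp
    also have "\<dots> \<le> (\<integral>\<zeta>. \<bar>K \<zeta> - f (m + n)\<bar> \<partial>\<rho> k)" by (rule integral_abs_bound)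
    also have "\<dots> \<le> (\<integral>\<zeta>. ?c * indicator A \<zeta> \<partial>\<rho> k)"
    proof (rule integral_mono_AE)
      show "integrable (\<rho> k) (\<lambda>\<zeta>. ?c * indicator A \<zeta>)"
        by (intro integrable_mult_right measure_pmf.integrable_const_bound[where B=1]) auto
      show "AE \<zeta> in \<rho> k. \<bar>K \<zeta> - f (m + n)\<bar> \<le> ?c * indicator A \<zeta>"
        using Kbd \<rho>[of k] by (auto simp: AE_measure_pmf_iff)
    qed (use Kint in simp)
    also have "\<dots> = ?c * measure_pmf.prob (\<rho> k) A" by simp
    finally show ?thesis .
  qed
  have prob: "measure_pmf.prob (\<rho> k) A = (\<integral>\<zeta>. measure_pmf.prob (dual_law (real k) \<zeta>) A \<partial>\<pi>)" for k
  proof -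
    have "ennreal (measure_pmf.prob (\<rho> k) A) = (\<integral>\<^sup>+\<zeta>. emeasure (dual_law (real k) \<zeta>) A \<partial>\<pi>)"
      unfolding \<rho>_def by (simp flip: measure_pmf.emeasure_eq_measure)
    also have "\<dots> = (\<integral>\<^sup>+\<zeta>. ennreal (measure_pmf.prob (dual_law (real k) \<zeta>) A) \<partial>\<pi>)"
      by (simp add: measure_pmf.emeasure_eq_measure)
    also have "\<dots> = ennreal (\<integral>\<zeta>. measure_pmf.prob (dual_law (real k) \<zeta>) A \<partial>\<pi>)"
      by (intro nn_integral_eq_integral measure_pmf.integrable_const_bound[where B=1]) auto
    finally show ?thesis by simp
  qed
  have "(\<lambda>k. \<integral>\<zeta>. measure_pmf.prob (dual_law (real k) \<zeta>) A \<partial>\<pi>) \<longlonglongrightarrow> (\<integral>\<zeta>. 0 \<partial>\<pi>)"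
  proof (rule integral_dominated_convergence[where w="\<lambda>_. 1"])
    show "AE \<zeta> in \<pi>. (\<lambda>k. measure_pmf.prob (dual_law (real k) \<zeta>) A) \<longlonglongrightarrow> 0"
      unfolding AE_measure_pmf_iff
    proof
      fix \<zeta> assume "\<zeta> \<in> set_pmf \<pi>"
      then have "\<zeta> \<in> fin_configs" using \<pi> nfin by blast
      from filterlim_compose[OF dual_law_spreads[OF this fin] filterlim_real_sequentially]
      show "(\<lambda>k. measure_pmf.prob (dual_law (real k) \<zeta>) A) \<longlonglongrightarrow> 0" unfolding A_def .
    qed
  qed auto
  then have "(\<lambda>k. measure_pmf.prob (\<rho> k) A) \<longlonglongrightarrow> 0" by (simp add: prob)
  from tendsto_mult[OF tendsto_const this, of ?c]
  have "(\<lambda>k. ?c * measure_pmf.prob (\<rho> k) A) \<longlonglongrightarrow> 0" by (simp only: mult_zero_right)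
  then have "(\<lambda>k. (\<integral>\<zeta>. K \<zeta> \<partial>\<rho> k) - f (m + n)) \<longlonglongrightarrow> 0"
  proof (rule Lim_null_comparison[rotated, where g="\<lambda>k. ?c * measure_pmf.prob (\<rho> k) A"])
    show "\<forall>\<^sub>F k in sequentially.
        norm ((\<integral>\<zeta>. K \<zeta> \<partial>\<rho> k) - f (m + n)) \<le> ?c * measure_pmf.prob (\<rho> k) A"
      using close by (intro always_eventually allI) (simp only: real_norm_def)
  qed
  then have "(\<lambda>k. \<integral>\<zeta>. K \<zeta> \<partial>\<rho> k) \<longlonglongrightarrow> f (m + n)" by (rule LIM_zero_cancel)
  then show ?thesis
    using integral_D_mult_mixture[OF \<xi> \<rho>] unfolding K_def \<rho>_def by simp
qed

lemma evolution_decreases_L2_norm: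
  assumes \<pi>: "set_pmf \<pi> \<subseteq> n_configs n" and t: "0 \<le> t"
  shows "(\<integral>\<eta>. (D_mixture D (bind_pmf \<pi> (dual_law t)) \<eta>)\<^sup>2 \<partial>\<mu>) \<le> (\<integral>\<eta>. (D_mixture D \<pi> \<eta>)\<^sup>2 \<partial>\<mu>)"
proof -
  let ?\<pi>' = "bind_pmf \<pi> (dual_law t)"
  note \<pi>' = set_bind_dual_law[OF \<pi> t]
  have "(\<integral>\<^sup>+\<eta>. ennreal ((D_mixture D ?\<pi>' \<eta>)\<^sup>2) \<partial>\<mu>)
      = (\<integral>\<^sup>+\<eta>. ennreal ((semigroup_op P t (D_mixture D \<pi>) \<eta>)\<^sup>2) \<partial>\<mu>)"
    using semigroup_op_D_mixture[OF \<pi> t] by (intro nn_integral_cong_AE, eventually_elim) simp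
  also have "\<dots> \<le> (\<integral>\<^sup>+\<eta>. ennreal ((D_mixture D \<pi> \<eta>)\<^sup>2) \<partial>\<mu>)"
    using config.semigroup_op_L2_contraction[OF sets_\<mu>\<^sub>\<Gamma> t bind_invariant[OF t]
        borel_measurable_E[OF borel_measurable_D_mixture[OF \<pi>]]]
    by (simp add: nn_integral_\<mu>\<^sub>\<Gamma>)
  finally have "ennreal (\<integral>\<eta>. (D_mixture D ?\<pi>' \<eta>)\<^sup>2 \<partial>\<mu>) \<le> ennreal (\<integral>\<eta>. (D_mixture D \<pi> \<eta>)\<^sup>2 \<partial>\<mu>)"
    using D_mixture_L2[OF \<pi>] D_mixture_L2[OF \<pi>'] by (simp add: nn_integral_eq_integral)
  then show ?thesis by simp
qed

text \<open>Parallelogram law: the midpoint of two near minimizers of the norm is again a mixture, so its norm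
is not below the infimum, and this leaves little room for the difference.\<close>

lemma near_minimizers_close:
  assumes \<pi>: "set_pmf \<pi> \<subseteq> n_configs n" and \<pi>': "set_pmf \<pi>' \<subseteq> n_configs n"
    and q: "\<And>\<rho>. set_pmf \<rho> \<subseteq> n_configs n \<Longrightarrow> q \<le> (\<integral>\<eta>. (D_mixture D \<rho> \<eta>)\<^sup>2 \<partial>\<mu>)"
    and a: "(\<integral>\<eta>. (D_mixture D \<pi> \<eta>)\<^sup>2 \<partial>\<mu>) \<le> q + a" and b: "(\<integral>\<eta>. (D_mixture D \<pi>' \<eta>)\<^sup>2 \<partial>\<mu>) \<le> q + b"
  shows "(\<integral>\<^sup>+\<eta>. ennreal ((D_mixture D \<pi> \<eta> - D_mixture D \<pi>' \<eta>)\<^sup>2) \<partial>\<mu>) \<le> ennreal (2 * a + 2 * b)"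
proof -
  let ?u = "D_mixture D \<pi>" and ?v = "D_mixture D \<pi>'"
  obtain \<rho> where \<rho>: "set_pmf \<rho> \<subseteq> n_configs n"
    and mid: "AE \<eta> in \<mu>. D_mixture D \<rho> \<eta> = (?u \<eta> + ?v \<eta>) / 2"
    using D_mixture_midpoint[OF \<pi> \<pi>'] by blast
  note i = D_mixture_L2[OF \<pi>] D_mixture_L2[OF \<pi>'] D_mixture_L2[OF \<rho>]
  have int: "integrable \<mu> (\<lambda>\<eta>. (?u \<eta> - ?v \<eta>)\<^sup>2)"
  proof -
    have "integrable \<mu> (\<lambda>\<eta>. (?u \<eta>)\<^sup>2 + (?v \<eta>)\<^sup>2 - 2 * (?u \<eta> * ?v \<eta>))"
      using i integrable_D_mixture_mult[OF \<pi> \<pi>'] by simp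
    then show ?thesis by (simp add: power2_diff mult.assoc)
  qed
  have "(\<integral>\<eta>. (?u \<eta> - ?v \<eta>)\<^sup>2 \<partial>\<mu>) = (\<integral>\<eta>. 2 * (?u \<eta>)\<^sup>2 + 2 * (?v \<eta>)\<^sup>2 - 4 * (D_mixture D \<rho> \<eta>)\<^sup>2 \<partial>\<mu>)"
  proof (rule integral_cong_AE)
    show "AE \<eta> in \<mu>. (?u \<eta> - ?v \<eta>)\<^sup>2 = 2 * (?u \<eta>)\<^sup>2 + 2 * (?v \<eta>)\<^sup>2 - 4 * (D_mixture D \<rho> \<eta>)\<^sup>2"
      using mid
    proof eventually_elim
      case (elim \<eta>)
      show ?case unfolding elim by (simp add: power2_eq_square field_simps)
    qed
  qed (use borel_measurable_D_mixture[OF \<pi>] borel_measurable_D_mixture[OF \<pi>']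
      borel_measurable_D_mixture[OF \<rho>] in measurable)
  also have "\<dots> = 2 * (\<integral>\<eta>. (?u \<eta>)\<^sup>2 \<partial>\<mu>) + 2 * (\<integral>\<eta>. (?v \<eta>)\<^sup>2 \<partial>\<mu>) - 4 * (\<integral>\<eta>. (D_mixture D \<rho> \<eta>)\<^sup>2 \<partial>\<mu>)"
    using i by simp
  also have "\<dots> \<le> 2 * a + 2 * b" using a b q[OF \<rho>] by simp
  finally show ?thesis using int by (simp add: nn_integral_eq_integral ennreal_leI)
qed

lemma minimizing_mixtures:
  obtains q \<pi> where "\<And>\<rho>. set_pmf \<rho> \<subseteq> n_configs n \<Longrightarrow> q \<le> (\<integral>\<eta>. (D_mixture D \<rho> \<eta>)\<^sup>2 \<partial>\<mu>)"
    and "\<And>k. set_pmf (\<pi> k) \<subseteq> n_configs n"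
    and "\<And>k. (\<integral>\<eta>. (D_mixture D (\<pi> k) \<eta>)\<^sup>2 \<partial>\<mu>) \<le> q + 1 / 4 ^ k"
proof -
  define N where "N \<pi> = (\<integral>\<eta>. (D_mixture D \<pi> \<eta>)\<^sup>2 \<partial>\<mu>)" for \<pi>
  define S where "S = {\<pi>. set_pmf \<pi> \<subseteq> (n_configs n :: 'g config set)}"
  define q where "q = (INF \<pi>\<in>S. N \<pi>)"
  have ne: "S \<noteq> {}"
    using single_site_in_n_configs[of undefined n] unfolding S_def
    by (auto intro!: exI[of _ "return_pmf (\<lambda>y. if y = undefined then n else 0)"])
  have bdd: "bdd_below (N ` S)"
    by (intro bdd_belowI[of _ 0]) (auto simp: N_def)
  have q: "q \<le> N \<pi>" if "set_pmf \<pi> \<subseteq> n_configs n" for \<pi>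
    unfolding q_def by (rule cINF_lower[OF bdd]) (use that in \<open>simp add: S_def\<close>)
  have "\<exists>\<pi>\<in>S. N \<pi> < q + 1 / 4 ^ k" for k :: nat
    using cINF_less_iff[OF ne bdd, of "q + 1 / 4 ^ k"] unfolding q_def by simp
  then obtain \<pi> where \<pi>: "\<And>k. set_pmf (\<pi> k) \<subseteq> n_configs n" and N\<pi>: "\<And>k. N (\<pi> k) \<le> q + 1 / 4 ^ k"
    unfolding S_def by (metis less_imp_le mem_Collect_eq)
  show thesis
    by (rule that[OF q[unfolded N_def] \<pi> N\<pi>[unfolded N_def]])
qed

text \<open>Evolving a near minimizer gives a mixture of no larger norm, hence a near minimizer again, and near
minimizers are close to each other. So the semigroup moves the members of the sequence less and
less, and, being a contraction, it fixes their limit.\<close>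

lemma limit_of_minimizing_mixtures_invariant:
  assumes q: "\<And>\<rho>. set_pmf \<rho> \<subseteq> n_configs n \<Longrightarrow> q \<le> (\<integral>\<eta>. (D_mixture D \<rho> \<eta>)\<^sup>2 \<partial>\<mu>)"
    and \<pi>: "\<And>k. set_pmf (\<pi> k) \<subseteq> n_configs n"
    and N\<pi>: "\<And>k. (\<integral>\<eta>. (D_mixture D (\<pi> k) \<eta>)\<^sup>2 \<partial>\<mu>) \<le> q + 1 / 4 ^ k"
    and g [measurable]: "g \<in> borel_measurable \<mu>"
    and limit: "\<And>k. (\<integral>\<^sup>+\<eta>. ennreal ((D_mixture D (\<pi> k) \<eta> - g \<eta>)\<^sup>2) \<partial>\<mu>) \<le> ennreal (4 / 4 ^ k)"
  shows "g \<in> L2 \<mu>" and "\<And>t. 0 \<le> t \<Longrightarrow> AE \<eta> in \<mu>. semigroup_op P t g \<eta> = g \<eta>"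
proof -
  define u where "u k = D_mixture D (\<pi> k)" for k
  note u_meas [measurable] = borel_measurable_D_mixture[OF \<pi>, folded u_def]
  note ug = limit[folded u_def]
  have u2: "(\<integral>\<^sup>+\<eta>. ennreal ((u k \<eta>)\<^sup>2) \<partial>\<mu>) < \<infinity>" for k
    using D_mixture_L2[OF \<pi>[of k]] unfolding u_def by (simp add: nn_integral_eq_integral)
  have g2: "(\<integral>\<^sup>+\<eta>. ennreal ((g \<eta>)\<^sup>2) \<partial>\<mu>) < \<infinity>"
  proof -
    have "(\<integral>\<^sup>+\<eta>. ennreal ((g \<eta>)\<^sup>2) \<partial>\<mu>)
        \<le> (\<integral>\<^sup>+\<eta>. ennreal 2 * ennreal ((u 0 \<eta>)\<^sup>2) + ennreal 2 * ennreal ((u 0 \<eta> - g \<eta>)\<^sup>2) \<partial>\<mu>)"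
    proof (rule nn_integral_mono)
      fix \<eta>
      have "0 \<le> (2 * u 0 \<eta> - g \<eta>)\<^sup>2" by simp
      then have "(g \<eta>)\<^sup>2 \<le> 2 * (u 0 \<eta>)\<^sup>2 + 2 * (u 0 \<eta> - g \<eta>)\<^sup>2"
        by (simp add: power2_eq_square algebra_simps)
      then have "ennreal ((g \<eta>)\<^sup>2) \<le> ennreal (2 * (u 0 \<eta>)\<^sup>2 + 2 * (u 0 \<eta> - g \<eta>)\<^sup>2)"
        by (rule ennreal_leI)
      also have "\<dots> = ennreal 2 * ennreal ((u 0 \<eta>)\<^sup>2) + ennreal 2 * ennreal ((u 0 \<eta> - g \<eta>)\<^sup>2)"
        by (simp only: ennreal_plus ennreal_mult zero_le_power2 mult_nonneg_nonneg zero_le_numeral)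
      finally show "ennreal ((g \<eta>)\<^sup>2) \<le> ennreal 2 * ennreal ((u 0 \<eta>)\<^sup>2) + ennreal 2 * ennreal ((u 0 \<eta> - g \<eta>)\<^sup>2)" .
    qed
    also have "\<dots> = ennreal 2 * (\<integral>\<^sup>+\<eta>. ennreal ((u 0 \<eta>)\<^sup>2) \<partial>\<mu>) + ennreal 2 * (\<integral>\<^sup>+\<eta>. ennreal ((u 0 \<eta> - g \<eta>)\<^sup>2) \<partial>\<mu>)"
      by (subst nn_integral_add) (auto simp: nn_integral_cmult)
    also have "\<dots> < \<infinity>"
      using u2[of 0] le_less_trans[OF ug[of 0]] by (auto simp: ennreal_mult_less_top)
    finally show ?thesis .
  qed
  show "g \<in> L2 \<mu>"
    unfolding L2_def using g2 by (auto intro!: integrableI_bounded)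
  show "AE \<eta> in \<mu>. semigroup_op P t g \<eta> = g \<eta>" if t: "0 \<le> t" for t
  proof -
    have Sg_meas [measurable]: "semigroup_op P t g \<in> borel_measurable \<mu>\<^sub>\<Gamma>" "g \<in> borel_measurable \<mu>\<^sub>\<Gamma>"
      using config.borel_measurable_semigroup_op[OF t borel_measurable_E[OF g]] borel_measurable_E[OF g] sets_\<mu>\<^sub>\<Gamma>
      by (simp_all cong: measurable_cong_sets)
    have bound: "(\<integral>\<^sup>+\<eta>. ennreal ((semigroup_op P t g \<eta> - g \<eta>)\<^sup>2) \<partial>\<mu>\<^sub>\<Gamma>) \<le> ennreal (36 / 4 ^ k)" for k
    proof -
      define \<pi>' where "\<pi>' = bind_pmf (\<pi> k) (dual_law t)"
      have \<pi>': "set_pmf \<pi>' \<subseteq> n_configs n" unfolding \<pi>'_def by (rule set_bind_dual_law[OF \<pi> t])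
      define v where "v = D_mixture D \<pi>'"
      have v_meas [measurable]: "v \<in> borel_measurable \<mu>"
        unfolding v_def by (rule borel_measurable_D_mixture[OF \<pi>'])
      have diff_E: "(\<lambda>\<eta>. u k \<eta> - g \<eta>) \<in> borel_measurable (restrict_space config_space \<Gamma>)"
        by (rule borel_measurable_E) measurable
      let ?w = "semigroup_op P t (\<lambda>\<eta>. u k \<eta> - g \<eta>)"
      have w_meas: "?w \<in> borel_measurable \<mu>\<^sub>\<Gamma>"
        using config.borel_measurable_semigroup_op[OF t diff_E] sets_\<mu>\<^sub>\<Gamma> by (simp cong: measurable_cong_sets)
      have v_meas': "(\<lambda>\<eta>. h1 \<eta> - h2 \<eta>) \<in> borel_measurable \<mu>\<^sub>\<Gamma>"
        if "h1 \<in> borel_measurable \<mu>" "h2 \<in> borel_measurable \<mu>" for h1 h2 :: "_ \<Rightarrow> real"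
        using that by (intro measurable_restrict_space1) measurable
      have w: "(\<integral>\<^sup>+\<eta>. ennreal ((?w \<eta>)\<^sup>2) \<partial>\<mu>\<^sub>\<Gamma>) \<le> ennreal (4 / 4 ^ k)"
        using config.semigroup_op_L2_contraction[OF sets_\<mu>\<^sub>\<Gamma> t bind_invariant[OF t] diff_E] ug[of k]
        by (simp add: nn_integral_\<mu>\<^sub>\<Gamma>)
      have vu: "(\<integral>\<^sup>+\<eta>. ennreal ((v \<eta> - u k \<eta>)\<^sup>2) \<partial>\<mu>\<^sub>\<Gamma>) \<le> ennreal (4 / 4 ^ k)"
      proof -
        have "(\<integral>\<eta>. (D_mixture D \<pi>' \<eta>)\<^sup>2 \<partial>\<mu>) \<le> q + 1 / 4 ^ k"
          using evolution_decreases_L2_norm[OF \<pi>[of k] t] N\<pi>[of k] unfolding \<pi>'_def by simp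
        then have "(\<integral>\<^sup>+\<eta>. ennreal ((v \<eta> - u k \<eta>)\<^sup>2) \<partial>\<mu>) \<le> ennreal (2 * (1 / 4 ^ k) + 2 * (1 / 4 ^ k))"
          unfolding u_def v_def
          by (intro near_minimizers_close[OF \<pi>' \<pi> q _ N\<pi>])
        then show ?thesis by (simp add: nn_integral_\<mu>\<^sub>\<Gamma>)
      qed
      have ug': "(\<integral>\<^sup>+\<eta>. ennreal ((u k \<eta> - g \<eta>)\<^sup>2) \<partial>\<mu>\<^sub>\<Gamma>) \<le> ennreal (4 / 4 ^ k)"
        using ug by (simp add: nn_integral_\<mu>\<^sub>\<Gamma>)
      have split: "AE \<eta> in \<mu>\<^sub>\<Gamma>. ?w \<eta> = v \<eta> - semigroup_op P t g \<eta>"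
      proof -
        have "AE \<eta> in \<mu>\<^sub>\<Gamma>. ?w \<eta> = semigroup_op P t (u k) \<eta> - semigroup_op P t g \<eta>"
          using u2[of k] g2
          by (intro config.semigroup_op_diff_AE[OF sets_\<mu>\<^sub>\<Gamma> t bind_invariant[OF t]] borel_measurable_E g u_meas)
             (simp_all add: nn_integral_\<mu>\<^sub>\<Gamma>)
        moreover have "AE \<eta> in \<mu>\<^sub>\<Gamma>. semigroup_op P t (u k) \<eta> = v \<eta>"
          using semigroup_op_D_mixture[OF \<pi>[of k] t] unfolding AE_\<mu>\<^sub>\<Gamma> u_def v_def \<pi>'_def .
        ultimately show ?thesis by eventually_elim simp
      qed
      \<comment> \<open>The path from the evolved \<open>g\<close> to \<open>g\<close> leads through the evolved \<open>u k\<close>, which is \<open>v\<close>, and \<open>u k\<close>.\<close>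
      have "(\<integral>\<^sup>+\<eta>. ennreal ((semigroup_op P t g \<eta> - g \<eta>)\<^sup>2) \<partial>\<mu>\<^sub>\<Gamma>)
        \<le> (\<integral>\<^sup>+\<eta>. ennreal 3 * (ennreal ((?w \<eta>)\<^sup>2) + ennreal ((v \<eta> - u k \<eta>)\<^sup>2) + ennreal ((u k \<eta> - g \<eta>)\<^sup>2)) \<partial>\<mu>\<^sub>\<Gamma>)"
        using split
      proof (intro nn_integral_mono_AE, eventually_elim)
        case (elim \<eta>)
        have sq3: "(- a + b + c)\<^sup>2 \<le> 3 * (a\<^sup>2 + b\<^sup>2 + c\<^sup>2)" for a b c :: real
        proof -
          have "0 \<le> (a + b)\<^sup>2 + (a + c)\<^sup>2 + (b - c)\<^sup>2" by simp
          then show ?thesis by (simp add: power2_eq_square algebra_simps)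
        qed
        have "semigroup_op P t g \<eta> - g \<eta> = - ?w \<eta> + (v \<eta> - u k \<eta>) + (u k \<eta> - g \<eta>)"
          using elim by simp
        then have "(semigroup_op P t g \<eta> - g \<eta>)\<^sup>2
            \<le> 3 * ((?w \<eta>)\<^sup>2 + (v \<eta> - u k \<eta>)\<^sup>2 + (u k \<eta> - g \<eta>)\<^sup>2)"
          by (simp only: sq3)
        then show ?case
          by (simp only: ennreal_plus[symmetric] ennreal_mult[symmetric] zero_le_power2 add_nonneg_nonneg
              zero_le_numeral ennreal_leI)      qed
      also have "\<dots> = ennreal 3 * ((\<integral>\<^sup>+\<eta>. ennreal ((?w \<eta>)\<^sup>2) \<partial>\<mu>\<^sub>\<Gamma>)
          + (\<integral>\<^sup>+\<eta>. ennreal ((v \<eta> - u k \<eta>)\<^sup>2) \<partial>\<mu>\<^sub>\<Gamma>) + (\<integral>\<^sup>+\<eta>. ennreal ((u k \<eta> - g \<eta>)\<^sup>2) \<partial>\<mu>\<^sub>\<Gamma>))"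
        using w_meas v_meas'[OF v_meas u_meas] v_meas'[OF u_meas g]
        by (simp add: nn_integral_cmult nn_integral_add)
      also have "\<dots> \<le> ennreal 3 * (ennreal (4 / 4 ^ k) + ennreal (4 / 4 ^ k) + ennreal (4 / 4 ^ k))"
        by (intro mult_left_mono add_mono w vu ug') simp
      also have "\<dots> = ennreal (36 / 4 ^ k)"
        by (simp flip: ennreal_plus ennreal_mult del: ennreal_numeral)
      finally show ?thesis .
    qed
    have "(\<lambda>k. ennreal (36 / 4 ^ k)) \<longlonglongrightarrow> ennreal 0"
      by (intro tendsto_ennrealI LIMSEQ_divide_realpow_zero) simp
    then have "(\<integral>\<^sup>+\<eta>. ennreal ((semigroup_op P t g \<eta> - g \<eta>)\<^sup>2) \<partial>\<mu>\<^sub>\<Gamma>) \<le> ennreal 0"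
      using bound by (intro LIMSEQ_le_const) auto
    then have "AE \<eta> in \<mu>\<^sub>\<Gamma>. ennreal ((semigroup_op P t g \<eta> - g \<eta>)\<^sup>2) = 0"
      by (subst (asm) ennreal_0, subst (asm) le_zero_eq, subst (asm) nn_integral_0_iff_AE) auto
    then show ?thesis unfolding AE_\<mu>\<^sub>\<Gamma> by eventually_elim simp
  qed
qed

text \<open>The limit of norm-minimizing mixtures is fixed by the semigroup, hence constant by ergodicity; the
constant is \<open>f n\<close> because every mixture has integral \<open>f n\<close>.\<close>

lemma mixtures_approach_constant:
  assumes erg: "ergodic_measure \<Gamma> P \<mu>" and \<epsilon>: "0 < \<epsilon>"
  shows "\<exists>\<pi>. set_pmf \<pi> \<subseteq> n_configs n \<and> (\<integral>\<eta>. (D_mixture D \<pi> \<eta> - f n)\<^sup>2 \<partial>\<mu>) \<le> \<epsilon>"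
proof -
  obtain q \<pi> where q: "\<And>\<rho>. set_pmf \<rho> \<subseteq> n_configs n \<Longrightarrow> q \<le> (\<integral>\<eta>. (D_mixture D \<rho> \<eta>)\<^sup>2 \<partial>\<mu>)"
    and \<pi>: "\<And>k. set_pmf (\<pi> k) \<subseteq> n_configs n"
    and N\<pi>: "\<And>k. (\<integral>\<eta>. (D_mixture D (\<pi> k) \<eta>)\<^sup>2 \<partial>\<mu>) \<le> q + 1 / 4 ^ k"
    using minimizing_mixtures[of n] by blast
  define u where "u k = D_mixture D (\<pi> k)" for k
  note u_meas [measurable] = borel_measurable_D_mixture[OF \<pi>, folded u_def]
  have Cauchy: "(\<integral>\<^sup>+\<eta>. ennreal ((u k \<eta> - u (k + j) \<eta>)\<^sup>2) \<partial>\<mu>) \<le> ennreal (4 / 4 ^ k)" for k j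
  proof -
    have "(\<integral>\<^sup>+\<eta>. ennreal ((u k \<eta> - u (k + j) \<eta>)\<^sup>2) \<partial>\<mu>) \<le> ennreal (2 * (1 / 4 ^ k) + 2 * (1 / 4 ^ (k + j)))"
      unfolding u_def
      by (rule near_minimizers_close[OF \<pi> \<pi> q N\<pi> N\<pi>])
    also have "\<dots> \<le> ennreal (4 / 4 ^ k)"
    proof (rule ennreal_leI)
      have "(1::real) / 4 ^ (k + j) \<le> 1 / 4 ^ k" by (intro divide_left_mono power_increasing) auto
      then show "2 * (1 / 4 ^ k) + 2 * (1 / 4 ^ (k + j)) \<le> (4 / 4 ^ k :: real)" by simp
    qed
    finally show ?thesis .
  qed
  obtain g where g [measurable]: "g \<in> borel_measurable \<mu>"
    and ug: "\<And>k. (\<integral>\<^sup>+\<eta>. ennreal ((u k \<eta> - g \<eta>)\<^sup>2) \<partial>\<mu>) \<le> ennreal (4 / 4 ^ k)"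
    using \<mu>.L2_limit_of_fast_Cauchy[OF u_meas _ Cauchy] by auto
  note lim = limit_of_minimizing_mixtures_invariant[OF q \<pi> N\<pi> g ug[unfolded u_def]]
  have gc: "AE \<eta> in \<mu>. g \<eta> = (\<integral>\<zeta>. g \<zeta> \<partial>\<mu>)"
    using erg lim unfolding ergodic_measure_def by blast
  define c where "c = (\<integral>\<zeta>. g \<zeta> \<partial>\<mu>)"
  have cbound: "(\<integral>\<^sup>+\<eta>. ennreal ((u k \<eta> - c)\<^sup>2) \<partial>\<mu>) \<le> ennreal (4 / 4 ^ k)" for k
  proof -
    have "(\<integral>\<^sup>+\<eta>. ennreal ((u k \<eta> - c)\<^sup>2) \<partial>\<mu>) = (\<integral>\<^sup>+\<eta>. ennreal ((u k \<eta> - g \<eta>)\<^sup>2) \<partial>\<mu>)"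
      using gc unfolding c_def by (intro nn_integral_cong_AE, eventually_elim) simp
    then show ?thesis using ug by simp
  qed
  have to0: "(\<lambda>k. 4 / 4 ^ k :: real) \<longlonglongrightarrow> 0"
    by (rule LIMSEQ_divide_realpow_zero) simp
  have "(f n - c)\<^sup>2 \<le> 4 / 4 ^ k" for k
  proof -
    have "(\<integral>\<eta>. u k \<eta> - c \<partial>\<mu>) = f n - c"
      using integrable_D_mixture[OF \<pi>[of k]] integral_D_mixture[OF \<pi>[of k]] unfolding u_def
      by (simp add: \<mu>.prob_space)
    then have "ennreal ((f n - c)\<^sup>2) \<le> ennreal (4 / 4 ^ k)"
      using order.trans[OF \<mu>.square_expectation_le_nn_integral_square[of "\<lambda>\<eta>. u k \<eta> - c"] cbound[of k]]
      by simp
    then show ?thesis by (subst (asm) ennreal_le_iff) simp_all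
  qed
  then have "(f n - c)\<^sup>2 \<le> 0" using to0 by (intro LIMSEQ_le_const[OF to0]) auto
  then have fc: "c = f n" by simp
  have "\<forall>\<^sub>F k in sequentially. 4 / 4 ^ k < \<epsilon>"
    using order_tendstoD(2)[OF to0 \<epsilon>] .
  then obtain k :: nat where k: "4 / 4 ^ k < \<epsilon>" by (auto simp: eventually_sequentially)
  have "ennreal (\<integral>\<eta>. (D_mixture D (\<pi> k) \<eta> - f n)\<^sup>2 \<partial>\<mu>) \<le> ennreal (4 / 4 ^ k)"
    using cbound[of k] integrable_centered_square[OF \<pi>[of k], of "f n"] unfolding u_def fc
    by (simp add: nn_integral_eq_integral)
  then have "(\<integral>\<eta>. (D_mixture D (\<pi> k) \<eta> - f n)\<^sup>2 \<partial>\<mu>) \<le> 4 / 4 ^ k"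
    by (subst (asm) ennreal_le_iff) simp_all
  then show ?thesis using \<pi>[of k] k by (intro exI[of _ "\<pi> k"]) auto
qed

text \<open>A mixture close to the constant \<open>f n\<close> stays close to it while it evolves, because its integral is
preserved and its norm does not increase. Its pairing with \<open>D \<xi>\<close> therefore stays close to
\<open>f m * f n\<close>, whereas it converges to \<open>f (m + n)\<close> as time goes to infinity.\<close>

lemma transform_multiplicative:
  assumes erg: "ergodic_measure \<Gamma> P \<mu>"
  shows "f (m + n) = f m * f n"
proof -
  obtain \<xi> :: "'g config" where \<xi>: "\<xi> \<in> n_configs m"
    by (rule that[OF single_site_in_n_configs[of undefined m]])
  have fin: "\<xi> \<in> fin_configs" using \<xi> n_configs_subset_fin_configs by blast
  define B where "B = (\<integral>\<eta>. (D \<xi> \<eta>)\<^sup>2 \<partial>\<mu>)"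
  have iD: "integrable \<mu> (\<lambda>\<eta>. (D \<xi> \<eta>)\<^sup>2)"
    using D_mixture_L2[of "return_pmf \<xi>"] \<xi> by (simp add: D_mixture_return)
  have le: "\<bar>f (m + n) - f m * f n\<bar> \<le> \<delta> * (B + 1)" if \<delta>: "0 < \<delta>" for \<delta>
  proof -
    obtain \<pi> where \<pi>: "set_pmf \<pi> \<subseteq> n_configs n"
      and small: "(\<integral>\<eta>. (D_mixture D \<pi> \<eta> - f n)\<^sup>2 \<partial>\<mu>) \<le> \<delta>\<^sup>2"
      using mixtures_approach_constant[OF erg, of "\<delta>\<^sup>2"] \<delta> by auto
    have "\<bar>(\<integral>\<eta>. D \<xi> \<eta> * D_mixture D (bind_pmf \<pi> (dual_law (real k))) \<eta> \<partial>\<mu>) - f m * f n\<bar> \<le> \<delta> * (B + 1)" for k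
    proof -
      define \<pi>' where "\<pi>' = bind_pmf \<pi> (dual_law (real k))"
      have \<pi>': "set_pmf \<pi>' \<subseteq> n_configs n" unfolding \<pi>'_def by (rule set_bind_dual_law[OF \<pi>]) simp
      define w where "w \<eta> = D_mixture D \<pi>' \<eta> - f n" for \<eta>
      have w2: "(\<integral>\<eta>. (w \<eta>)\<^sup>2 \<partial>\<mu>) \<le> \<delta>\<^sup>2"
        using evolution_decreases_L2_norm[OF \<pi>, of "real k"] small
        unfolding w_def integral_D_mixture_centered_square[OF \<pi>] integral_D_mixture_centered_square[OF \<pi>']
        by (simp add: \<pi>'_def)
      have iw: "integrable \<mu> (\<lambda>\<eta>. (w \<eta>)\<^sup>2)"
        unfolding w_def by (rule integrable_centered_square[OF \<pi>'])
      have iDm: "integrable \<mu> (\<lambda>\<eta>. D \<xi> \<eta> * D_mixture D \<pi>' \<eta>)"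
        using integrable_D_mixture_mult[of "return_pmf \<xi>" m \<pi>' n] \<xi> \<pi>' by (simp add: D_mixture_return)
      have iDw: "integrable \<mu> (\<lambda>\<eta>. D \<xi> \<eta> * w \<eta>)"
        unfolding w_def right_diff_distrib using iDm integrable_D[OF fin] by simp
      have "(\<integral>\<eta>. D \<xi> \<eta> * D_mixture D \<pi>' \<eta> \<partial>\<mu>) - f m * f n = (\<integral>\<eta>. D \<xi> \<eta> * w \<eta> \<partial>\<mu>)"
        unfolding w_def right_diff_distrib using iDm integrable_D[OF fin] integral_D[OF \<xi>] by simp
      also have "\<bar>\<dots>\<bar> \<le> (\<integral>\<eta>. \<bar>D \<xi> \<eta> * w \<eta>\<bar> \<partial>\<mu>)" by (rule integral_abs_bound)
      \<comment> \<open>Young's inequality, weighted so that a norm of order \<open>\<delta>\<close> of \<open>w\<close> gives a bound of order \<open>\<delta>\<close>.\<close>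
      also have "\<dots> \<le> (\<integral>\<eta>. \<delta> * (D \<xi> \<eta>)\<^sup>2 + (w \<eta>)\<^sup>2 / \<delta> \<partial>\<mu>)"
      proof (rule integral_mono)
        show "integrable \<mu> (\<lambda>\<eta>. \<bar>D \<xi> \<eta> * w \<eta>\<bar>)" using iDw by (rule integrable_abs)
        show "integrable \<mu> (\<lambda>\<eta>. \<delta> * (D \<xi> \<eta>)\<^sup>2 + (w \<eta>)\<^sup>2 / \<delta>)" using iD iw by simp
        fix \<eta>
        have "0 \<le> (\<delta> * \<bar>D \<xi> \<eta>\<bar> - \<bar>w \<eta>\<bar>)\<^sup>2" by simp
        then have "2 * (\<delta> * \<bar>D \<xi> \<eta> * w \<eta>\<bar>) \<le> \<delta>\<^sup>2 * (D \<xi> \<eta>)\<^sup>2 + (w \<eta>)\<^sup>2"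
          by (simp add: power2_diff power_mult_distrib abs_mult mult_ac)
        moreover have "0 \<le> \<delta> * \<bar>D \<xi> \<eta> * w \<eta>\<bar>" using \<delta> by simp
        ultimately have "\<delta> * \<bar>D \<xi> \<eta> * w \<eta>\<bar> \<le> \<delta>\<^sup>2 * (D \<xi> \<eta>)\<^sup>2 + (w \<eta>)\<^sup>2" by linarith
        then show "\<bar>D \<xi> \<eta> * w \<eta>\<bar> \<le> \<delta> * (D \<xi> \<eta>)\<^sup>2 + (w \<eta>)\<^sup>2 / \<delta>"
          using \<delta> by (simp add: field_simps power2_eq_square)
      qed
      also have "\<dots> = \<delta> * B + (\<integral>\<eta>. (w \<eta>)\<^sup>2 \<partial>\<mu>) / \<delta>"
        using iD iw by (simp add: B_def)
      also have "\<dots> \<le> \<delta> * B + \<delta>\<^sup>2 / \<delta>"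
        using w2 \<delta> by (intro add_left_mono divide_right_mono) auto
      also have "\<dots> = \<delta> * (B + 1)" using \<delta> by (simp add: power2_eq_square algebra_simps)
      finally show ?thesis unfolding \<pi>'_def .
    qed
    moreover have "(\<lambda>k. \<bar>(\<integral>\<eta>. D \<xi> \<eta> * D_mixture D (bind_pmf \<pi> (dual_law (real k))) \<eta> \<partial>\<mu>) - f m * f n\<bar>)
        \<longlonglongrightarrow> \<bar>f (m + n) - f m * f n\<bar>"
      by (intro tendsto_rabs tendsto_diff tendsto_const D_mixture_evolution_decorrelates[OF \<xi> \<pi>])
    ultimately show ?thesis by (intro LIMSEQ_le_const2) auto
  qed
  have B0: "0 \<le> B" unfolding B_def by simp
  have "\<bar>f (m + n) - f m * f n\<bar> \<le> 0"
  proof (rule field_le_epsilon)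
    fix e :: real assume e: "0 < e"
    then have "0 < e / (B + 1)" using B0 by simp
    from le[OF this] show "\<bar>f (m + n) - f m * f n\<bar> \<le> 0 + e" using B0 by simp
  qed
  then show ?thesis by simp
qed

lemma transform_power:
  assumes erg: "ergodic_measure \<Gamma> P \<mu>"
  shows "f n = f 1 ^ n"
proof (induction n)
  case 0
  have "(\<lambda>_. 0) \<in> n_configs 0" using single_site_in_n_configs[of undefined 0] by simp
  from integral_D[OF this] show ?case using \<mu>.prob_space by (simp add: D_empty)
next
  case (Suc n)
  then show ?case using transform_multiplicative[OF erg, of n 1] by simp
qed

section \<open>Product measures\<close>

text \<open>The transform of the product of the one-site marginals factorizes over sites, and the transform at
a configuration on a single site is the same under \<open>\<mu>\<close> and under the product. A transform
\<open>f 1 ^ n\<close> factorizes in the same way, so the two transforms agree, and a tempered measure is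
determined by its transform.\<close>

lemma product_measureI:
  assumes pow: "\<And>n. f n = f 1 ^ n"
  shows "product_measure \<mu>"
proof -
  define \<nu> where "\<nu> x = distr \<mu> (count_space UNIV) (\<lambda>\<eta>. \<eta> x)" for x :: 'g
  have coord: "(\<lambda>\<eta>. \<eta> x) \<in> \<mu> \<rightarrow>\<^sub>M count_space UNIV" for x
  proof -
    have "(\<lambda>\<eta>. \<eta> x) \<in> config_space \<rightarrow>\<^sub>M count_space UNIV"
      unfolding config_space_def by (rule measurable_component_singleton) simp
    then show ?thesis using measurable_cong_sets[OF sets_\<mu> refl] by blast
  qed
  have \<nu>_prob: "prob_space (\<nu> x)" for x
    unfolding \<nu>_def by (rule \<mu>.prob_space_distr[OF coord])
  interpret prod: product_prob_space \<nu> UNIV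
    by (intro product_prob_spaceI \<nu>_prob)
  let ?M = "\<Pi>\<^sub>M x\<in>UNIV. \<nu> x"
  have sets_M: "sets ?M = sets config_space"
    unfolding config_space_def by (rule sets_PiM_cong) (simp_all add: \<nu>_def)
  have M_prob: "?M \<in> space (prob_algebra config_space)"
    using sets_M prod.prob_space_axioms by (simp add: space_prob_algebra)
  have d_site: "integrable (\<nu> x) (d k)" "(\<integral>j. d k j \<partial>\<nu> x) = f k" for x k
  proof -
    let ?\<xi> = "\<lambda>y. if y = x then k else 0"
    have \<xi>: "?\<xi> \<in> n_configs k" by (rule single_site_in_n_configs)
    then have fin: "?\<xi> \<in> fin_configs" using n_configs_subset_fin_configs by blast
    have "{y. ?\<xi> y \<noteq> 0} \<subseteq> {x}" by auto
    from D_prod[OF _ this] have "D ?\<xi> \<eta> = d k (\<eta> x)" for \<eta> by simp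
    then have D: "D ?\<xi> = (\<lambda>\<eta>. d k (\<eta> x))" by (simp add: fun_eq_iff)
    show "integrable (\<nu> x) (d k)"
      unfolding \<nu>_def using integrable_D[OF fin] by (subst integrable_distr_eq[OF coord]) (simp_all add: D)
    show "(\<integral>j. d k j \<partial>\<nu> x) = f k"
      unfolding \<nu>_def using integral_D[OF \<xi>] by (subst integral_distr[OF coord]) (simp_all add: D)
  qed
  have "integrable ?M (D \<xi>) \<and> D_transform D ?M \<xi> = f n" if \<xi>: "\<xi> \<in> n_configs n" for \<xi> n
  proof -
    define J where "J = {x. \<xi> x \<noteq> 0}"
    have J: "finite J" using finite_support_n_configs[OF \<xi>] by (simp add: J_def)

    have distr: "distr ?M (PiM J \<nu>) (\<lambda>\<eta>. restrict \<eta> J) = PiM J \<nu>"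
      using J by (intro prod.distr_PiM_restrict_finite) auto
    have restr: "(\<lambda>\<eta>. restrict \<eta> J) \<in> ?M \<rightarrow>\<^sub>M PiM J \<nu>"
      by (intro measurable_restrict_subset) auto
    have D: "D \<xi> = (\<lambda>\<eta>. (\<Prod>x\<in>J. d (\<xi> x) (restrict \<eta> J x)))"
      using J by (auto simp: fun_eq_iff D_prod[of J \<xi>] J_def)
    have int: "integrable (PiM J \<nu>) (\<lambda>\<eta>. \<Prod>x\<in>J. d (\<xi> x) (\<eta> x))"
      using J d_site by (intro prod.product_integrable_prod) auto
    have "(\<integral>\<eta>. (\<Prod>x\<in>J. d (\<xi> x) (\<eta> x)) \<partial>PiM J \<nu>) = (\<Prod>x\<in>J. \<integral>j. d (\<xi> x) j \<partial>\<nu> x)"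
      using J d_site by (intro prod.product_integral_prod) auto
    also have "\<dots> = (\<Prod>x\<in>J. f 1 ^ \<xi> x)" by (simp only: d_site(2) pow[symmetric])
    also have "\<dots> = f 1 ^ (\<Sum>x\<in>J. \<xi> x)" by (simp add: power_sum)
    also have "(\<Sum>x\<in>J. \<xi> x) = n"
      using \<xi> num_particles_superset[OF J, of \<xi>] by (simp add: J_def n_configs_def)
    also have "f 1 ^ n = f n" by (rule pow[symmetric])
    finally have val: "(\<integral>\<eta>. (\<Prod>x\<in>J. d (\<xi> x) (\<eta> x)) \<partial>PiM J \<nu>) = f n" .
    have "integrable ?M (D \<xi>)"
      unfolding D by (rule integrable_distr[OF restr]) (simp add: distr int)
    moreover have "D_transform D ?M \<xi> = f n"
      unfolding D_transform_def D
      using integral_distr[OF restr borel_measurable_integrable[OF int]] distr val by simp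
    ultimately show ?thesis by simp
  qed
  then have M_transform: "D_integrable D ?M" "\<forall>\<xi>\<in>fin_configs. D_transform D \<mu> \<xi> = D_transform D ?M \<xi>"
    using transform_const by (auto simp: D_integrable_def elim!: fin_configsE)
  have "\<mu> = ?M"
    using tempered M_prob M_transform unfolding tempered_def by blast
  moreover have "\<nu> x \<in> space (prob_algebra (count_space UNIV))" for x
    using \<nu>_prob[of x] by (simp add: space_prob_algebra) (simp add: \<nu>_def)
  ultimately show ?thesis
    unfolding product_measure_def by (intro exI[of _ \<nu>] conjI allI)
qed

end

theorem theorem3p1:
  fixes \<Gamma> :: "('g::countable) config set"
    and W Wd :: "(real \<Rightarrow> 'g config) set"
    and P Pd :: "'g config \<Rightarrow> (real \<Rightarrow> 'g config) measure"
    and D :: "'g config \<Rightarrow> 'g config \<Rightarrow> real"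
    and d :: "nat \<Rightarrow> nat \<Rightarrow> real"
  assumes "dual_config_process \<Gamma> W P Wd Pd D d"
    and "admits_successful_coupling Pd"
  shows "(\<forall>\<mu>. tempered D \<mu> \<and> invariant_measure \<Gamma> P \<mu> \<longrightarrow>
            (\<exists>f :: nat \<Rightarrow> real. (\<forall>n. 0 \<le> f n) \<and>
              (\<forall>n. \<forall>\<xi>\<in>n_configs n. D_transform D \<mu> \<xi> = f n))) \<and>
         (\<forall>\<mu>. tempered D \<mu> \<and> invariant_measure \<Gamma> P \<mu> \<and> ergodic_measure \<Gamma> P \<mu> \<longrightarrow>
            (\<forall>f :: nat \<Rightarrow> real. (\<forall>n. 0 \<le> f n) \<and>
              (\<forall>n. \<forall>\<xi>\<in>n_configs n. D_transform D \<mu> \<xi> = f n) \<longrightarrow> (\<forall>n. f n = f 1 ^ n)) \<and>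
            product_measure \<mu>)"
proof -
  have const: "\<exists>f :: nat \<Rightarrow> real. (\<forall>n. 0 \<le> f n) \<and> (\<forall>n. \<forall>\<xi>\<in>n_configs n. D_transform D \<mu> \<xi> = f n)"
    if \<mu>: "tempered D \<mu>" "invariant_measure \<Gamma> P \<mu>" for \<mu>
  proof -
    interpret tempered_invariant_measure \<Gamma> W P Wd Pd D d \<mu>
      using assms(1) \<mu> by (intro tempered_invariant_measure.intro tempered_invariant_measure_axioms.intro)
    let ?\<xi> = "\<lambda>n y. if y = (undefined :: 'g) then n else (0 :: nat)"
    have \<xi>: "?\<xi> n \<in> n_configs n" for n by (rule single_site_in_n_configs)
    have "0 \<le> D_transform D \<mu> (?\<xi> n)" for n
      using D_transform_nonneg n_configs_subset_fin_configs \<xi> by blast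
    moreover have "D_transform D \<mu> \<xi> = D_transform D \<mu> (?\<xi> n)" if "\<xi> \<in> n_configs n" for \<xi> n
      by (rule D_transform_constant[OF assms(2) that \<xi>])
    ultimately show ?thesis
      by (intro exI[of _ "\<lambda>n. D_transform D \<mu> (?\<xi> n)"] conjI allI ballI)
  qed
  have power: "(\<forall>n. f n = f 1 ^ n) \<and> product_measure \<mu>"
    if \<mu>: "tempered D \<mu>" "invariant_measure \<Gamma> P \<mu>" "ergodic_measure \<Gamma> P \<mu>"
      and f: "\<forall>n. \<forall>\<xi>\<in>n_configs n. D_transform D \<mu> \<xi> = f n" for \<mu> and f :: "nat \<Rightarrow> real"
  proof -
    interpret constant_transform \<Gamma> W P Wd Pd D d \<mu> f
      using assms(1) \<mu> f
      by (intro constant_transform.intro tempered_invariant_measure.intro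
          tempered_invariant_measure_axioms.intro constant_transform_axioms.intro) auto
    have pow: "f n = f 1 ^ n" for n by (rule transform_power[OF \<mu>(3)])
    show ?thesis using pow product_measureI[OF pow] by blast
  qed
  show ?thesis
  proof (intro conjI allI impI)
    fix \<mu> assume "tempered D \<mu> \<and> invariant_measure \<Gamma> P \<mu>"
    then show "\<exists>f :: nat \<Rightarrow> real. (\<forall>n. 0 \<le> f n) \<and> (\<forall>n. \<forall>\<xi>\<in>n_configs n. D_transform D \<mu> \<xi> = f n)"
      using const by blast
  next
    fix \<mu> and f :: "nat \<Rightarrow> real" and n
    assume "tempered D \<mu> \<and> invariant_measure \<Gamma> P \<mu> \<and> ergodic_measure \<Gamma> P \<mu>"
      and "(\<forall>n. 0 \<le> f n) \<and> (\<forall>n. \<forall>\<xi>\<in>n_configs n. D_transform D \<mu> \<xi> = f n)"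
    then have "(\<forall>n. f n = f 1 ^ n) \<and> product_measure \<mu>" by (intro power) blast+
    then show "f n = f 1 ^ n" by (rule conjunct1[THEN spec])
  next
    fix \<mu> assume \<mu>: "tempered D \<mu> \<and> invariant_measure \<Gamma> P \<mu> \<and> ergodic_measure \<Gamma> P \<mu>"
    then obtain f :: "nat \<Rightarrow> real" where "\<forall>n. \<forall>\<xi>\<in>n_configs n. D_transform D \<mu> \<xi> = f n"
      using const[of \<mu>] by blast
    with \<mu> show "product_measure \<mu>" using power[of \<mu> f] by blast
  qed
qed

end
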